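(* Let $L$ be a finite-dimensional solvable, $\phi$-free, minimally non-supersolvable Leibniz algebra over a field $F$. Then $L$ has one of the following forms. (1) If $L$ is strongly solvable, then $L=A\dotplus\langle x\rangle$ (vector space direct sum), where $A$ is the unique minimal ideal of $L$, $\dim A>1$, and $\langle x\rangle=Fx$ is a one-dimensional Lie subalgebra. (2) If $L$ is not strongly solvable, then $F$ has characteristic $p>0$, $L$ has a unique minimal ideal $A$ with basis $\{e_1,\dots,e_p\}$, and one of the following holds (indices of the $e_i$ are taken mod $p$): (a) $L=A\dotplus B$, where $B$ is a Lie subalgebra with basis $\{x,y\}$, with $yx=x$, $xe_i=e_{i+1}$, $ye_i=(\alpha+i)e_i$ for some $\alpha\in F$, and for every $a\in F$ there is $t\in F$ with $a=t^p-t$; or (b) $L=A\dotplus B$, where $B$ is a Lie subalgebra with basis $\{x,y,z\}$, with $yx=z$, $xz=yz=0$, $xe_i=e_{i+1}$, $ye_i=(i+1)e_{i-1}$, $ze_i=e_i$, and $F$ is perfect when $p=2$. If $L$ is a Lie algebra, the multiplication in these forms is antisymmetric. If $L$ is not a Lie algebra, then in addition $A=\mathrm{Leib}(L)$ and $AL=0$.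
   Context: A (left) Leibniz algebra is an algebra satisfying $a(bc)=(ab)c+b(ac)$; it is a Lie algebra if its product is antisymmetric ($xx=0$ for all $x$). Ideals are two-sided. $\mathrm{Leib}(L)$ is the span of all squares $xx$, $x\in L$; $AL$ is the span of all products $au$, $a\in A$, $u\in L$. The Frattini subalgebra of $L$ is the intersection of all maximal subalgebras; the Frattini ideal $\phi(L)$ is the largest ideal of $L$ contained in it; $L$ is $\phi$-free if $\phi(L)=0$. $L$ is strongly solvable if $L^2$ (the span of all products) is nilpotent. $L$ is supersolvable if there is a chain of ideals $0=L_0\subset L_1\subset\cdots\subset L_n=L$ of $L$ with $\dim L_i=i$. $L$ is minimally non-supersolvable if $L$ is not supersolvable but every proper subalgebra of $L$ is. In the multiplication tables, products within the Lie subalgebra $B$ are antisymmetric, products of two elements of $A$ are zero, and the products $e_iu$ with $u\in B$ are $-ue_i$ if $L$ is Lie and $0$ if $L$ is not Lie. The forms listed are necessary; it is not claimed that every algebra of these forms is minimally non-supersolvable. *)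

theory Defs
  imports Complex_Main
begin

definition perfect_field :: "'f::field itself \<Rightarrow> bool" where
  "perfect_field _ \<longleftrightarrow> CHAR('f) = 0 \<or> (\<forall>a::'f. \<exists>b. b ^ CHAR('f) = a)"

locale leibniz_algebra = vector_space scale
  for scale :: "'f::field \<Rightarrow> 'a::ab_group_add \<Rightarrow> 'a" (infixr \<open>*s\<close> 75) +
  fixes mult :: "'a \<Rightarrow> 'a \<Rightarrow> 'a" (infixl \<open>\<cdot>\<close> 70)
  assumes linear_mult_left: "Vector_Spaces.linear scale scale (\<lambda>a. a \<cdot> b)"
    and linear_mult_right: "Vector_Spaces.linear scale scale (\<lambda>b. a \<cdot> b)"
    and leibniz: "a \<cdot> (b \<cdot> c) = (a \<cdot> b) \<cdot> c + b \<cdot> (a \<cdot> c)"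
begin

text \<open>
  The algebra \<open>L\<close> is the whole type. Notions that are needed for subalgebras as well are
  relative to a set \<open>S\<close> (a subalgebra, \<open>L\<close> being \<open>UNIV\<close>), which is then regarded as an algebra
  of its own.
\<close>

definition subalgebra :: "'a set \<Rightarrow> bool" where
  "subalgebra S \<longleftrightarrow> subspace S \<and> (\<forall>a\<in>S. \<forall>b\<in>S. a \<cdot> b \<in> S)"

definition ideal_of :: "'a set \<Rightarrow> 'a set \<Rightarrow> bool" where
  "ideal_of S I \<longleftrightarrow> subspace I \<and> I \<subseteq> S \<and> (\<forall>a\<in>I. \<forall>s\<in>S. a \<cdot> s \<in> I \<and> s \<cdot> a \<in> I)"

definition product_space :: "'a set \<Rightarrow> 'a set \<Rightarrow> 'a set" where
  "product_space A B = span {a \<cdot> b | a b. a \<in> A \<and> b \<in> B}"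

definition lie :: "'a set \<Rightarrow> bool" where
  "lie S \<longleftrightarrow> (\<forall>x\<in>S. x \<cdot> x = 0)"

definition Leib :: "'a set \<Rightarrow> 'a set" where
  "Leib S = span {x \<cdot> x | x. x \<in> S}"

fun derived_series :: "'a set \<Rightarrow> nat \<Rightarrow> 'a set" where
  "derived_series S 0 = S"
| "derived_series S (Suc n) = product_space (derived_series S n) (derived_series S n)"

definition solvable :: "'a set \<Rightarrow> bool" where
  "solvable S \<longleftrightarrow> (\<exists>n. derived_series S n = {0})"

text \<open>
  In a left Leibniz algebra \<open>(a \<cdot> b) \<cdot> c = a \<cdot> (b \<cdot> c) - b \<cdot> (a \<cdot> c)\<close>, so every product of \<open>n\<close> elements
  is a combination of right-normed ones; the lower central series is therefore formed by
  multiplying with the whole algebra from the left.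
\<close>

fun lower_central_series :: "'a set \<Rightarrow> nat \<Rightarrow> 'a set" where
  "lower_central_series S 0 = S"
| "lower_central_series S (Suc n) = product_space S (lower_central_series S n)"

definition nilpotent :: "'a set \<Rightarrow> bool" where
  "nilpotent S \<longleftrightarrow> (\<exists>n. lower_central_series S n = {0})"

definition strongly_solvable :: "'a set \<Rightarrow> bool" where
  "strongly_solvable S \<longleftrightarrow> nilpotent (product_space S S)"

definition supersolvable :: "'a set \<Rightarrow> bool" where
  "supersolvable S \<longleftrightarrow>
     (\<exists>(n::nat) I. I 0 = {0} \<and> I n = S \<and> (\<forall>i<n. I i \<subset> I (Suc i)) \<and>
        (\<forall>i\<le>n. ideal_of S (I i) \<and> dim (I i) = i))"

definition minimally_non_supersolvable :: "'a set \<Rightarrow> bool" where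
  "minimally_non_supersolvable S \<longleftrightarrow>
     \<not> supersolvable S \<and> (\<forall>T. subalgebra T \<and> T \<subset> S \<longrightarrow> supersolvable T)"

definition maximal_subalgebra :: "'a set \<Rightarrow> bool" where
  "maximal_subalgebra M \<longleftrightarrow>
     subalgebra M \<and> M \<noteq> UNIV \<and> (\<forall>T. subalgebra T \<and> M \<subseteq> T \<longrightarrow> T = M \<or> T = UNIV)"

definition Frattini_subalgebra :: "'a set" where
  "Frattini_subalgebra = \<Inter>{M. maximal_subalgebra M}"

text \<open>
  The sum of all ideals of \<open>L\<close> contained in the Frattini subalgebra; by
  \<open>Frattini_ideal_greatest\<close> below it is the largest such ideal.
\<close>

definition Frattini_ideal :: "'a set" where
  "Frattini_ideal = span (\<Union>{I. ideal_of UNIV I \<and> I \<subseteq> Frattini_subalgebra})"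

lemma subspace_Frattini_subalgebra: "subspace Frattini_subalgebra"
  unfolding Frattini_subalgebra_def
  by (rule subspace_Inter) (auto simp: maximal_subalgebra_def subalgebra_def)

lemma Frattini_ideal_greatest:
  shows "ideal_of UNIV Frattini_ideal"
    and "Frattini_ideal \<subseteq> Frattini_subalgebra"
    and "ideal_of UNIV I \<Longrightarrow> I \<subseteq> Frattini_subalgebra \<Longrightarrow> I \<subseteq> Frattini_ideal"
proof -
  let ?U = "\<Union>{I. ideal_of UNIV I \<and> I \<subseteq> Frattini_subalgebra}"
  have l: "module_hom scale scale (\<lambda>a. a \<cdot> s)" and r: "module_hom scale scale (\<lambda>a. s \<cdot> a)" for s
    using linear_mult_left[of s] linear_mult_right[of s] by (simp_all add: module_hom_iff_linear)
  have l': "a \<cdot> s \<in> span ?U" if "a \<in> span ?U" for a s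
  proof -
    have "(\<lambda>a. a \<cdot> s) ` span ?U = span ((\<lambda>a. a \<cdot> s) ` ?U)"
      by (rule module_hom.span_image[OF l, symmetric])
    also have "\<dots> \<subseteq> span ?U"
      by (rule span_mono) (fastforce simp: ideal_of_def)
    finally show ?thesis using that by blast
  qed
  have r': "s \<cdot> a \<in> span ?U" if "a \<in> span ?U" for a s
  proof -
    have "(\<lambda>a. s \<cdot> a) ` span ?U = span ((\<lambda>a. s \<cdot> a) ` ?U)"
      by (rule module_hom.span_image[OF r, symmetric])
    also have "\<dots> \<subseteq> span ?U"
      by (rule span_mono) (fastforce simp: ideal_of_def)
    finally show ?thesis using that by blast
  qed
  show "ideal_of UNIV Frattini_ideal"
    unfolding ideal_of_def[of UNIV Frattini_ideal] unfolding Frattini_ideal_def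
    using l' r' by (auto simp: subspace_span)
  show "Frattini_ideal \<subseteq> Frattini_subalgebra"
    unfolding Frattini_ideal_def by (rule span_minimal) (auto simp: subspace_Frattini_subalgebra)
  show "I \<subseteq> Frattini_ideal" if "ideal_of UNIV I" "I \<subseteq> Frattini_subalgebra"
    unfolding Frattini_ideal_def using that by (auto intro: span_base)
qed

definition phi_free :: bool where
  "phi_free \<longleftrightarrow> Frattini_ideal = {0}"

definition minimal_ideal :: "'a set \<Rightarrow> bool" where
  "minimal_ideal A \<longleftrightarrow> ideal_of UNIV A \<and> A \<noteq> {0} \<and>
     (\<forall>I. ideal_of UNIV I \<and> I \<subseteq> A \<longrightarrow> I = {0} \<or> I = A)"

definition unique_minimal_ideal :: "'a set \<Rightarrow> bool" where
  "unique_minimal_ideal A \<longleftrightarrow> minimal_ideal A \<and> (\<forall>I. minimal_ideal I \<longrightarrow> I = A)"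

definition direct_sum :: "'a set \<Rightarrow> 'a set \<Rightarrow> bool" where
  "direct_sum A B \<longleftrightarrow> subspace A \<and> subspace B \<and> A \<inter> B = {0} \<and> {a + b | a b. a \<in> A \<and> b \<in> B} = UNIV"

definition is_basis :: "'a list \<Rightarrow> 'a set \<Rightarrow> bool" where
  "is_basis vs V \<longleftrightarrow> distinct vs \<and> independent (set vs) \<and> span (set vs) = V"

text \<open>
  The products that are suppressed in the multiplication tables. The antisymmetry of the
  products within the complement \<open>B\<close> is expressed by \<open>lie B\<close>.
\<close>

definition table_conventions :: "'a set \<Rightarrow> 'a set \<Rightarrow> bool" where
  "table_conventions A B \<longleftrightarrow>
     (\<forall>a\<in>A. \<forall>b\<in>A. a \<cdot> b = 0) \<and>
     (\<forall>a\<in>A. \<forall>u\<in>B. a \<cdot> u = (if lie UNIV then - (u \<cdot> a) else 0))"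

text \<open>
  The basis of \<open>A\<close> is indexed by \<open>int\<close>, periodically modulo \<open>p\<close>, so that \<open>of_int i\<close> is the
  residue class of the index \<open>i\<close> in the prime field.
\<close>

definition cyclic_basis :: "(int \<Rightarrow> 'a) \<Rightarrow> 'a set \<Rightarrow> bool" where
  "cyclic_basis e A \<longleftrightarrow>
     (\<forall>i. e (i + int CHAR('f)) = e i) \<and> is_basis (map e [1..int CHAR('f)]) A"

definition form_strongly_solvable :: "'a set \<Rightarrow> bool" where
  "form_strongly_solvable A \<longleftrightarrow>
     dim A > 1 \<and>
     (\<exists>x. x \<noteq> 0 \<and> subalgebra (span {x}) \<and> lie (span {x}) \<and> direct_sum A (span {x}) \<and>
          table_conventions A (span {x}))"

definition form_a :: "'a set \<Rightarrow> (int \<Rightarrow> 'a) \<Rightarrow> bool" where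
  "form_a A e \<longleftrightarrow>
     (\<exists>B x y \<alpha>. direct_sum A B \<and> subalgebra B \<and> lie B \<and> is_basis [x, y] B \<and>
        y \<cdot> x = x \<and>
        (\<forall>i. x \<cdot> e i = e (i + 1)) \<and>
        (\<forall>i. y \<cdot> e i = (\<alpha> + of_int i) *s e i) \<and>
        table_conventions A B) \<and>
     (\<forall>a::'f. \<exists>t. a = t ^ CHAR('f) - t)"

definition form_b :: "'a set \<Rightarrow> (int \<Rightarrow> 'a) \<Rightarrow> bool" where
  "form_b A e \<longleftrightarrow>
     (\<exists>B x y z. direct_sum A B \<and> subalgebra B \<and> lie B \<and> is_basis [x, y, z] B \<and>
        y \<cdot> x = z \<and> x \<cdot> z = 0 \<and> y \<cdot> z = 0 \<and>
        (\<forall>i. x \<cdot> e i = e (i + 1)) \<and>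
        (\<forall>i. y \<cdot> e i = of_int (i + 1) *s e (i - 1)) \<and>
        (\<forall>i. z \<cdot> e i = e i) \<and>
        table_conventions A B) \<and>
     (CHAR('f) = 2 \<longrightarrow> perfect_field TYPE('f))"

end

end

theory Submission
  imports Defs "HOL-Computational_Algebra.Polynomial"
begin

text \<open>
  A minimal ideal \<open>A\<close> is abelian and, \<open>L\<close> being \<open>\<phi>\<close>-free, has a supersolvable complement \<open>B\<close>. A
  second minimal ideal, or \<open>dim A = 1\<close>, would make \<open>L\<close> supersolvable, and uniqueness of \<open>A\<close> forces
  \<open>B\<close> to be a Lie algebra acting faithfully and irreducibly on \<open>A\<close>. Since \<open>A + S\<close> is
  supersolvable for every proper subalgebra \<open>S\<close> of \<open>B\<close>, such an \<open>S\<close> has a common eigenvector in every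
  nonzero \<open>S\<close>-invariant subspace of \<open>A\<close>.

  If \<open>B\<close> is abelian and not a line, all its elements are scalars on \<open>A\<close> by Schur's argument, which is
  absurd; \<open>L\<close> is strongly solvable exactly when \<open>B\<close> is abelian. Otherwise \<open>B\<close> contains \<open>x, y\<close> with
  either \<open>yx = x\<close> and \<open>\<langle>x\<rangle>\<close> an ideal, or \<open>yx = z\<close> central and acting as \<open>1\<close>. The subalgebra they generate
  has no common eigenvector, so it is \<open>B\<close>. In both cases \<open>x\<^sup>p\<close> commutes with \<open>B\<close> and is a
  scalar, and powers of \<open>x\<close> applied to an eigenvector of \<open>y\<close> give the cyclic basis; it consists of
  eigenvectors of \<open>y\<close>, respectively \<open>x \<circ> y\<close>, for eigenvalues \<open>\<alpha> + i\<close>, which also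
  excludes characteristic \<open>0\<close>. The conditions on \<open>F\<close> result from \<open>y + a x\<close> having an eigenvalue in \<open>F\<close>.
\<close>

section \<open>Leibniz algebras and minimal ideals\<close>

locale finite_dimensional_leibniz_algebra =
  leibniz_algebra scale mult + finite_dimensional_vector_space scale Basis
  for scale :: "'f::field \<Rightarrow> 'a::ab_group_add \<Rightarrow> 'a" (infixr \<open>*s\<close> 75)
    and mult :: "'a \<Rightarrow> 'a \<Rightarrow> 'a" (infixl \<open>\<cdot>\<close> 70)
    and Basis :: "'a set"

context leibniz_algebra
begin

lemma mult_add_left: "(a + b) \<cdot> c = a \<cdot> c + b \<cdot> c"
  and mult_scale_left: "(k *s a) \<cdot> c = k *s (a \<cdot> c)"
  using linear_mult_left[of c] by (simp_all add: Vector_Spaces.linear_iff)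

lemma mult_add_right: "c \<cdot> (a + b) = c \<cdot> a + c \<cdot> b"
  and mult_scale_right: "c \<cdot> (k *s a) = k *s (c \<cdot> a)"
  using linear_mult_right[of c] by (simp_all add: Vector_Spaces.linear_iff)

lemma mult_left_zero [simp]: "0 \<cdot> c = 0"
  using mult_add_left[of 0 0 c] by simp

lemma mult_right_zero [simp]: "c \<cdot> 0 = 0"
  using mult_add_right[of c 0 0] by simp

lemma mult_left_minus: "(- a) \<cdot> c = - (a \<cdot> c)"
  using mult_add_left[of a "- a" c] by (simp add: minus_unique)

lemma mult_right_minus: "c \<cdot> (- a) = - (c \<cdot> a)"
  using mult_add_right[of c a "- a"] by (simp add: minus_unique)

lemma mult_diff_left: "(a - b) \<cdot> c = a \<cdot> c - b \<cdot> c"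
  using mult_add_left[of a "- b" c] by (simp add: mult_left_minus)

lemma mult_diff_right: "c \<cdot> (a - b) = c \<cdot> a - c \<cdot> b"
  using mult_add_right[of c a "- b"] by (simp add: mult_right_minus)

lemmas mult_simps = mult_add_left mult_add_right mult_scale_left mult_scale_right
  mult_left_minus mult_right_minus mult_diff_left mult_diff_right

lemma leibniz_left: "(a \<cdot> b) \<cdot> c = a \<cdot> (b \<cdot> c) - b \<cdot> (a \<cdot> c)"
  by (simp add: leibniz[of a b c])

lemma square_mult [simp]: "(a \<cdot> a) \<cdot> b = 0"
  by (simp add: leibniz_left)

lemma lie_antisym:
  assumes "subspace S" "lie S" "a \<in> S" "b \<in> S"
  shows "a \<cdot> b = - (b \<cdot> a)"
proof -
  have "(a + b) \<cdot> (a + b) = 0" "a \<cdot> a = 0" "b \<cdot> b = 0"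
    using assms subspace_add[of S a b] by (auto simp: lie_def)
  thus ?thesis by (simp add: mult_simps eq_neg_iff_add_eq_0 add.commute)
qed

lemma ideal_of_subspace: "ideal_of S I \<Longrightarrow> subspace I"
  and ideal_of_subset: "ideal_of S I \<Longrightarrow> I \<subseteq> S"
  and ideal_of_mult_left: "ideal_of S I \<Longrightarrow> s \<in> S \<Longrightarrow> a \<in> I \<Longrightarrow> s \<cdot> a \<in> I"
  by (auto simp: ideal_of_def)

lemma subalgebra_subspace: "subalgebra S \<Longrightarrow> subspace S"
  and subalgebra_mult: "subalgebra S \<Longrightarrow> a \<in> S \<Longrightarrow> b \<in> S \<Longrightarrow> a \<cdot> b \<in> S"
  by (auto simp: subalgebra_def)

lemma ideal_of_inter: "ideal_of S I \<Longrightarrow> ideal_of S J \<Longrightarrow> ideal_of S (I \<inter> J)"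
  by (auto simp: ideal_of_def subspace_inter)

lemma subspace_nontrivial: "subspace S \<Longrightarrow> S \<noteq> {0} \<Longrightarrow> \<exists>u\<in>S. u \<noteq> 0"
  using subspace_0 by blast

lemma ideal_of_span_singleton:
  assumes "subspace S" "u \<in> S" "\<And>s. s \<in> S \<Longrightarrow> u \<cdot> s \<in> span {u}" "\<And>s. s \<in> S \<Longrightarrow> s \<cdot> u \<in> span {u}"
  shows "ideal_of S (span {u})"
  unfolding ideal_of_def
proof (intro conjI ballI)
  show "span {u} \<subseteq> S" using assms span_minimal[of "{u}" S] by auto
  fix a s assume "a \<in> span {u}" "s \<in> S"
  then obtain k where "a = k *s u" by (auto simp: span_singleton)
  with assms(3,4)[OF \<open>s \<in> S\<close>] show "a \<cdot> s \<in> span {u}" "s \<cdot> a \<in> span {u}"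
    by (auto simp: mult_simps span_scale)
qed auto

section \<open>Product spaces, squares and the ideals they span\<close>

lemma mult_in_product_space: "a \<in> A \<Longrightarrow> b \<in> B \<Longrightarrow> a \<cdot> b \<in> product_space A B"
  unfolding product_space_def by (rule span_base) blast

lemma product_space_subset:
  assumes "subspace C" "\<And>a b. a \<in> A \<Longrightarrow> b \<in> B \<Longrightarrow> a \<cdot> b \<in> C"
  shows "product_space A B \<subseteq> C"
  unfolding product_space_def using assms by (intro span_minimal) auto

lemma subspace_product_space: "subspace (product_space A B)"
  by (simp add: product_space_def)

lemma product_space_mono: "A \<subseteq> A' \<Longrightarrow> B \<subseteq> B' \<Longrightarrow> product_space A B \<subseteq> product_space A' B'"
  by (rule product_space_subset) (auto simp: subspace_product_space intro: mult_in_product_space)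

lemma ideal_of_spanI:
  assumes "\<And>a s. a \<in> X \<Longrightarrow> a \<cdot> s \<in> span X" "\<And>a s. a \<in> X \<Longrightarrow> s \<cdot> a \<in> span X"
  shows "ideal_of UNIV (span X)"
proof -
  have "subspace {a. \<forall>s. a \<cdot> s \<in> span X \<and> s \<cdot> a \<in> span X}"
    by (rule subspaceI) (auto simp: mult_simps span_zero span_add span_scale)
  hence "span X \<subseteq> {a. \<forall>s. a \<cdot> s \<in> span X \<and> s \<cdot> a \<in> span X}"
    using assms by (intro span_minimal) auto
  thus ?thesis by (auto simp: ideal_of_def)
qed

text \<open>On generators the Leibniz identity gives \<open>(ab)s = a(bs) - b(as)\<close> and
  \<open>s(ab) = (sa)b + a(sb)\<close>, and every factor on the right lies in \<open>A\<close>
  again.\<close>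

lemma ideal_of_product_space:
  assumes A: "ideal_of UNIV A"
  shows "ideal_of UNIV (product_space A A)"
proof -
  let ?X = "{a \<cdot> b | a b. a \<in> A \<and> b \<in> A}"
  have *: "a \<cdot> b \<in> span ?X" if "a \<in> A" "b \<in> A" for a b
    using that by (intro span_base) blast
  have A': "s \<cdot> a \<in> A" "a \<cdot> s \<in> A" if "a \<in> A" for a s
    using that A by (auto simp: ideal_of_def)
  have "(a \<cdot> b) \<cdot> s \<in> span ?X" "s \<cdot> (a \<cdot> b) \<in> span ?X" if "a \<in> A" "b \<in> A" for a b s
    unfolding leibniz_left[of a b] leibniz[of s] using that A'[of a s] A'[of b s]
    by (auto intro!: span_diff span_add *)
  thus ?thesis unfolding product_space_def by (intro ideal_of_spanI) blast+
qed

text \<open>Polarization: \<open>s(xx) = (sx)x + x(sx)\<close> is the mixed term of the square of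
  \<open>sx + x\<close>, hence a combination of squares. Products with a square on the left vanish
  by \<open>square_mult\<close>.\<close>

lemma ideal_of_Leib: "ideal_of UNIV (Leib UNIV)"
proof -
  let ?X = "{x \<cdot> x | x. x \<in> UNIV}"
  have "s \<cdot> (x \<cdot> x) \<in> span ?X" for s x
  proof -
    have "s \<cdot> (x \<cdot> x) = (s \<cdot> x + x) \<cdot> (s \<cdot> x + x) - (s \<cdot> x) \<cdot> (s \<cdot> x) - x \<cdot> x"
      by (simp add: mult_simps leibniz[of s x x])
    also have "\<dots> \<in> span ?X" by (intro span_diff span_base) auto
    finally show ?thesis .
  qed
  thus ?thesis unfolding Leib_def by (intro ideal_of_spanI) (auto simp: span_zero)
qed

lemma Leib_mult: "a \<in> Leib S \<Longrightarrow> a \<cdot> b = 0"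
proof -
  have "subspace {a. a \<cdot> b = 0}" by (rule subspaceI) (auto simp: mult_simps)
  hence "Leib S \<subseteq> {a. a \<cdot> b = 0}" unfolding Leib_def by (intro span_minimal) auto
  thus "a \<in> Leib S \<Longrightarrow> a \<cdot> b = 0" by blast
qed

text \<open>By minimality \<open>AA\<close> is \<open>0\<close> or \<open>A\<close>; in the second
  case \<open>A\<close> would survive in every term of the derived series.\<close>

lemma minimal_ideal_abelian:
  assumes "solvable UNIV" "minimal_ideal A" "a \<in> A" "b \<in> A"
  shows "a \<cdot> b = 0"
proof -
  have A: "ideal_of UNIV A" "A \<noteq> {0}" using assms by (auto simp: minimal_ideal_def)
  have "product_space A A \<subseteq> A"
    using A by (intro product_space_subset) (auto simp: ideal_of_def)
  with assms(2) ideal_of_product_space[OF A(1)]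
  have "product_space A A = {0} \<or> product_space A A = A" by (auto simp: minimal_ideal_def)
  moreover have False if eq: "product_space A A = A"
  proof -
    have "A \<subseteq> derived_series UNIV n" for n
      by (induction n) (use product_space_mono[of A _ A] eq in auto)
    with assms(1) have "A \<subseteq> {0}" unfolding solvable_def by metis
    with A show False using subspace_0[OF ideal_of_subspace[OF A(1)]] by blast
  qed
  ultimately show ?thesis using mult_in_product_space[OF assms(3,4)] by auto
qed

section \<open>Splitting off a minimal ideal\<close>

lemma direct_sumE:
  assumes "direct_sum A B"
  obtains a b where "a \<in> A" "b \<in> B" "u = a + b"
  using assms UNIV_I[of u] unfolding direct_sum_def by blast

lemma span_eq_self: "subspace S \<Longrightarrow> span S = S"
  by simp

text \<open>Some maximal subalgebra \<open>B\<close> does not contain \<open>A\<close>, and the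
  subalgebra \<open>A + B\<close> must then be everything. As \<open>A\<close> is abelian, only the
  \<open>B\<close>-component of a factor acts on \<open>A \<inter> B\<close>; this makes the
  intersection an ideal, which minimality forces to be \<open>0\<close>.\<close>

lemma minimal_ideal_complement:
  assumes solv: "solvable UNIV" and free: "phi_free" and min: "minimal_ideal A"
  obtains B where "subalgebra B" "B \<noteq> UNIV" "direct_sum A B"
proof -
  have A: "ideal_of UNIV A" "A \<noteq> {0}" using min by (auto simp: minimal_ideal_def)
  note sA = ideal_of_subspace[OF A(1)]
  have AA: "a \<cdot> b = 0" if "a \<in> A" "b \<in> A" for a b
    using minimal_ideal_abelian[OF solv min] that .
  have "\<not> A \<subseteq> Frattini_subalgebra"
    using Frattini_ideal_greatest(3)[OF A(1)] A free subspace_0[OF sA] by (auto simp: phi_free_def)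
  then obtain B where B: "maximal_subalgebra B" "\<not> A \<subseteq> B"
    by (auto simp: Frattini_subalgebra_def)
  hence B': "subalgebra B" "B \<noteq> UNIV" by (auto simp: maximal_subalgebra_def)
  note sB = subalgebra_subspace[OF B'(1)]
  define S where "S = {a + b | a b. a \<in> A \<and> b \<in> B}"
  have "subspace S" unfolding S_def using sA sB by (rule subspace_sums)
  moreover have "u \<cdot> v \<in> S" if uv: "u \<in> S" "v \<in> S" for u v
  proof -
    obtain a b a' b' where *: "a \<in> A" "b \<in> B" "a' \<in> A" "b' \<in> B" "u = a + b" "v = a' + b'"
      using uv unfolding S_def by blast
    have "u \<cdot> v = (a \<cdot> b' + b \<cdot> a') + b \<cdot> b'" using * by (simp add: mult_simps AA)
    moreover have "a \<cdot> b' + b \<cdot> a' \<in> A" "b \<cdot> b' \<in> B"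
      using * A(1) B'(1) sA by (auto simp: ideal_of_def subalgebra_def subspace_add)
    ultimately show ?thesis unfolding S_def by blast
  qed
  ultimately have "subalgebra S" unfolding subalgebra_def by blast
  moreover have "B \<subseteq> S" unfolding S_def using subspace_0[OF sA] by force
  ultimately have "S = B \<or> S = UNIV" using B(1) unfolding maximal_subalgebra_def by metis
  moreover have "A \<subseteq> S" unfolding S_def using subspace_0[OF sB] by force
  ultimately have S: "{a + b | a b. a \<in> A \<and> b \<in> B} = UNIV" unfolding S_def[symmetric] using B(2) by metis
  have "ideal_of UNIV (A \<inter> B)"
    unfolding ideal_of_def
  proof (intro conjI ballI)
    show "subspace (A \<inter> B)" using sA sB by (rule subspace_inter)
    fix c s assume c: "c \<in> A \<inter> B"
    obtain a b where s: "a \<in> A" "b \<in> B" "s = a + b" using S by blast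
    hence "c \<cdot> s = c \<cdot> b" "s \<cdot> c = b \<cdot> c" using c by (auto simp: mult_simps AA)
    moreover have "c \<cdot> b \<in> B" "b \<cdot> c \<in> B" using c s B'(1) by (auto simp: subalgebra_def)
    moreover have "c \<cdot> b \<in> A" "b \<cdot> c \<in> A" using c A(1) by (auto simp: ideal_of_def)
    ultimately show "c \<cdot> s \<in> A \<inter> B" "s \<cdot> c \<in> A \<inter> B" by simp_all
  qed auto
  moreover have "A \<inter> B \<noteq> A" using B(2) by blast
  ultimately have "A \<inter> B = {0}" using min unfolding minimal_ideal_def by blast
  hence "direct_sum A B" using S sA sB by (auto simp: direct_sum_def)
  thus thesis using that B' by blast
qed

end

section \<open>Supersolvable chains and uniqueness of the minimal ideal\<close>

context finite_dimensional_leibniz_algebra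
begin

lemma codim_one_span:
  assumes "subspace V" "subspace W" "V \<subseteq> W" "dim W = Suc (dim V)" "x \<in> W" "x \<notin> V"
  shows "span (insert x V) = W"
proof (rule subspace_dim_equal)
  show "span (insert x V) \<subseteq> W" using assms by (intro span_minimal) auto
  have "span V = V" using assms(1) by (rule span_eq_self)
  thus "dim W \<le> dim (span (insert x V))" using assms(4,6) by (simp only: dim_insert dim_span if_False)
qed (use assms in auto)

text \<open>At the first term of the chain that meets \<open>J\<close> nontrivially, the previous
  term meets \<open>J\<close> in \<open>0\<close> and has codimension one, so the intersection with
  \<open>J\<close> is a line.\<close>

lemma supersolvable_ideal_line:
  assumes "supersolvable S" "ideal_of S J" "J \<noteq> {0}"
  shows "\<exists>u\<in>J. u \<noteq> 0 \<and> ideal_of S (span {u})"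
proof -
  obtain n I where I: "I 0 = {0}" "I n = S" "\<forall>i<n. I i \<subset> I (Suc i)"
    "\<forall>i\<le>n. ideal_of S (I i) \<and> dim (I i) = i"
    using assms(1) unfolding supersolvable_def by blast
  define P where "P i \<longleftrightarrow> i \<le> n \<and> I i \<inter> J \<noteq> {0}" for i
  have "P n" using I(2) assms(2,3) ideal_of_subset by (auto simp: P_def inf_absorb2)
  hence P: "P (LEAST i. P i)" by (rule LeastI)
  have "(LEAST i. P i) \<noteq> 0"
    using P I(1) subspace_0[OF ideal_of_subspace[OF assms(2)]] by (metis P_def Int_insert_left_if1 inf_bot_left)
  then obtain k where k: "(LEAST i. P i) = Suc k" by (cases "LEAST i. P i") auto
  hence "\<not> P k" using not_less_Least[of k P] by simp
  with P k have kn: "Suc k \<le> n" and Ik: "I k \<inter> J = {0}" and Isk: "I (Suc k) \<inter> J \<noteq> {0}"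
    by (auto simp: P_def)
  have id: "ideal_of S (I k)" "ideal_of S (I (Suc k))" and dims: "dim (I k) = k" "dim (I (Suc k)) = Suc k"
    using I(4) kn by auto
  have sub: "I k \<subseteq> I (Suc k)" using I(3) kn by (simp add: psubset_imp_subset)
  have idJ: "ideal_of S (I (Suc k) \<inter> J)" using id(2) assms(2) by (rule ideal_of_inter)
  obtain u where u: "u \<in> I (Suc k)" "u \<in> J" "u \<noteq> 0"
    using subspace_nontrivial[OF ideal_of_subspace[OF idJ] Isk] by auto
  have "u \<notin> I k" using u Ik by blast
  hence eq: "span (insert u (I k)) = I (Suc k)"
    using u sub dims id by (intro codim_one_span) (auto dest: ideal_of_subspace)
  have sIk: "span (I k) = I k" using ideal_of_subspace[OF id(1)] by (rule span_eq_self)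
  \<comment> \<open>Subtracting the multiple of \<open>u\<close> that leads back to
    \<open>I k\<close> keeps the vector in \<open>J\<close>, hence in
    \<open>I k \<inter> J\<close>.\<close>
  have line: "w \<in> span {u}" if w: "w \<in> I (Suc k) \<inter> J" for w
  proof -
    from w eq obtain c where c: "w - c *s u \<in> I k" using span_breakdown_eq sIk by blast
    moreover have "w - c *s u \<in> J"
      using w u ideal_of_subspace[OF assms(2)] by (auto intro: subspace_diff subspace_scale)
    ultimately have "w - c *s u = 0" using Ik by blast
    hence "w = c *s u" by simp
    thus ?thesis by (auto simp: span_singleton)
  qed
  have "subspace S" using I(2,4) ideal_of_subspace[of S "I n"] by auto
  hence "ideal_of S (span {u})"
    using u id(2) idJ by (intro ideal_of_span_singleton line) (auto simp: ideal_of_def)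
  thus ?thesis using u by blast
qed

text \<open>The line is added to every term of the chain of \<open>B\<close>: products involving the
  line stay in the line, and products of \<open>B\<close> with \<open>I k\<close> stay in
  \<open>I k\<close>.\<close>

lemma supersolvable_extension:
  assumes A: "ideal_of UNIV (span {u})" "u \<noteq> 0" and B: "supersolvable B" "direct_sum (span {u}) B"
  shows "supersolvable UNIV"
proof -
  obtain n I where I: "I 0 = {0}" "I n = B" "\<forall>i<n. I i \<subset> I (Suc i)"
    "\<forall>i\<le>n. ideal_of B (I i) \<and> dim (I i) = i"
    using B(1) unfolding supersolvable_def by blast
  \<comment> \<open>The index shifts by one: \<open>J 1\<close> is the line itself, and
    \<open>J (Suc k)\<close> is the line plus \<open>I k\<close>.\<close>
  define J where "J i = (case i of 0 \<Rightarrow> {0} | Suc k \<Rightarrow> span (insert u (I k)))" for i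
  have J_alt: "span (insert u (I k)) = {a + b | a b. a \<in> span {u} \<and> b \<in> I k}" if "k \<le> n" for k
    using span_Un[of "{u}" "I k"] I(4) that by (simp add: ideal_of_def span_eq_self)
  have dimJ: "dim (J i) = i" if "i \<le> Suc n" for i
  proof (cases i)
    case (Suc k)
    hence k: "ideal_of B (I k)" "dim (I k) = k" using I(4) that by auto
    moreover have "u \<notin> I k" using B(2) k A(2) span_base[of u "{u}"] ideal_of_subset[OF k(1)]
      by (auto simp: direct_sum_def)
    ultimately show ?thesis
      using Suc by (simp add: J_def dim_insert ideal_of_def span_eq_self)
  qed (simp add: J_def)
  have idJ: "ideal_of UNIV (J i)" if "i \<le> Suc n" for i
  proof (cases i)
    case 0 thus ?thesis by (auto simp: J_def ideal_of_def)
  next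
    case (Suc k)
    hence k: "ideal_of B (I k)" using I(4) that by auto
    have uJ: "span {u} \<subseteq> J i" unfolding J_def using Suc by (auto intro!: span_mono)
    have IJ: "I k \<subseteq> J i" unfolding J_def using Suc by (auto intro: span_base)
    have sJ: "subspace (J i)" by (auto simp: J_def Suc)
    show ?thesis
      unfolding ideal_of_def
    proof (intro conjI ballI)
      fix c s assume "c \<in> J i"
      moreover have "J i = {a + b | a b. a \<in> span {u} \<and> b \<in> I k}"
        using J_alt[of k] Suc that by (simp add: J_def)
      ultimately obtain a b where c: "a \<in> span {u}" "b \<in> I k" "c = a + b"
        by blast
      obtain a' b' where s: "a' \<in> span {u}" "b' \<in> B" "s = a' + b'"
        using direct_sumE[OF B(2)] by metis
      have 1: "v \<cdot> w \<in> J i" "w \<cdot> v \<in> J i" if "v \<in> span {u}" for v w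
        using that A(1) uJ by (auto simp: ideal_of_def)
      have 2: "b \<cdot> b' \<in> J i" "b' \<cdot> b \<in> J i"
        using IJ k c s by (auto simp: ideal_of_def)
      show "c \<cdot> s \<in> J i" "s \<cdot> c \<in> J i"
        unfolding c s mult_add_left mult_add_right
        using 1[OF c(1)] 1[OF s(1)] 2 sJ by (auto intro!: subspace_add)
    qed (use sJ in auto)
  qed
  have "J i \<subset> J (Suc i)" if "i \<le> n" for i
  proof -
    have "J i \<subseteq> J (Suc i)"
    proof (cases i)
      case 0 thus ?thesis by (auto simp: J_def span_zero)
    next
      case (Suc k)
      hence "I k \<subseteq> I (Suc k)" using I(3) that by (simp add: psubset_imp_subset)
      thus ?thesis by (auto simp: J_def Suc intro!: span_mono)
    qed
    moreover have "J i \<noteq> J (Suc i)" using dimJ[of i] dimJ[of "Suc i"] that by auto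
    ultimately show ?thesis by blast
  qed
  moreover have "J (Suc n) = UNIV"
    using J_alt[of n] I(2) B(2) by (auto simp: J_def direct_sum_def)
  moreover have "J 0 = {0}" by (simp add: J_def)
  ultimately show ?thesis
    unfolding supersolvable_def using idJ dimJ
    by (intro exI[of _ "Suc n"] exI[of _ J]) auto
qed

lemma minimal_ideal_exists:
  assumes "ideal_of UNIV J" "J \<noteq> {0}"
  shows "\<exists>A. minimal_ideal A \<and> A \<subseteq> J"
  using assms
proof (induction "dim J" arbitrary: J rule: less_induct)
  case less
  show ?case
  proof (cases "minimal_ideal J")
    case False
    then obtain K where K: "ideal_of UNIV K" "K \<subseteq> J" "K \<noteq> {0}" "K \<noteq> J"
      using less.prems by (auto simp: minimal_ideal_def)
    hence "dim K < dim J"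
      using less.prems ideal_of_subspace by (intro dim_psubset) (simp add: span_eq_self psubset_eq)
    from less.hyps[OF this K(1,3)] K(2) show ?thesis by blast
  qed blast
qed

text \<open>If \<open>A\<close> and \<open>A'\<close> differ, they meet in \<open>0\<close>. The
  ideal \<open>(A + A') \<inter> B'\<close> of the supersolvable complement \<open>B'\<close> of
  \<open>A'\<close> contains an ideal line of \<open>B'\<close>; the \<open>A\<close>-component of
  its generator spans an ideal of the whole algebra, so \<open>A\<close> is a line and its
  supersolvable complement makes the algebra supersolvable.\<close>

lemma minimal_ideals_eq:
  assumes solv: "solvable UNIV" and free: "phi_free" and mns: "minimally_non_supersolvable UNIV"
    and A: "minimal_ideal A" and A': "minimal_ideal A'"
  shows "A = A'"
proof (rule ccontr)
  assume ne: "A \<noteq> A'"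
  have idA: "ideal_of UNIV A" "A \<noteq> {0}" and idA': "ideal_of UNIV A'"  "A' \<noteq> {0}"
    using A A' by (auto simp: minimal_ideal_def)
  note sA = ideal_of_subspace[OF idA(1)] and sA' = ideal_of_subspace[OF idA'(1)]
  have idI: "ideal_of UNIV (A \<inter> A')" using idA idA' by (intro ideal_of_inter)
  have I0: "A \<inter> A' = {0}"
  proof (rule ccontr)
    assume "A \<inter> A' \<noteq> {0}"
    with A A' idI have "A \<inter> A' = A" "A \<inter> A' = A'"
      unfolding minimal_ideal_def by (metis inf_le1, metis inf_le2)
    with ne show False by simp
  qed
  obtain B where B: "subalgebra B" "B \<noteq> UNIV" "direct_sum A B"
    using minimal_ideal_complement[OF solv free A] .
  obtain B' where B': "subalgebra B'" "B' \<noteq> UNIV" "direct_sum A' B'"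
    using minimal_ideal_complement[OF solv free A'] .
  have ss: "supersolvable B" "supersolvable B'" and nss: "\<not> supersolvable UNIV"
    using mns B B' by (auto simp: minimally_non_supersolvable_def)
  note sB' = subalgebra_subspace[OF B'(1)]
  let ?S = "{a + a' | a a'. a \<in> A \<and> a' \<in> A'}"
  have sS: "subspace ?S" using sA sA' by (rule subspace_sums)
  have "ideal_of B' (?S \<inter> B')"
    unfolding ideal_of_def
  proof (intro conjI ballI)
    show "subspace (?S \<inter> B')" using sS sB' by (rule subspace_inter)
    fix c s assume c: "c \<in> ?S \<inter> B'" and s: "s \<in> B'"
    then obtain a a' where *: "c = a + a'" "a \<in> A" "a' \<in> A'" by blast
    have "a \<cdot> s \<in> A" "s \<cdot> a \<in> A" "a' \<cdot> s \<in> A'" "s \<cdot> a' \<in> A'"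
      using * idA idA' by (auto simp: ideal_of_def)
    moreover have "c \<cdot> s = a \<cdot> s + a' \<cdot> s" "s \<cdot> c = s \<cdot> a + s \<cdot> a'" by (simp_all add: * mult_simps)
    ultimately have "c \<cdot> s \<in> ?S" "s \<cdot> c \<in> ?S" by blast+
    moreover have "c \<cdot> s \<in> B'" "s \<cdot> c \<in> B'" using c s B'(1) by (auto simp: subalgebra_def)
    ultimately show "c \<cdot> s \<in> ?S \<inter> B'" "s \<cdot> c \<in> ?S \<inter> B'" by simp_all
  qed auto
  \<comment> \<open>For nonzero \<open>a\<close> in \<open>A\<close>, split as
    \<open>a' + b'\<close> along \<open>A'\<close> and \<open>B'\<close>, the component
    \<open>b' = a - a'\<close> is a nonzero element of the intersection.\<close>
  moreover have "?S \<inter> B' \<noteq> {0}"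
  proof
    assume z: "?S \<inter> B' = {0}"
    obtain a where a: "a \<in> A" "a \<noteq> 0" using subspace_nontrivial[OF sA idA(2)] by blast
    obtain a' b' where *: "a' \<in> A'" "b' \<in> B'" "a = a' + b'" using direct_sumE[OF B'(3)] by metis
    have "b' = a + (- a')" using * by simp
    moreover have "- a' \<in> A'" using * sA' by (simp add: subspace_neg)
    ultimately have "b' \<in> ?S \<inter> B'" using * a by blast
    hence "b' = 0" using z by blast
    hence "a \<in> A \<inter> A'" using a(1) * by simp
    with a(2) I0 show False by simp
  qed
  ultimately have "\<exists>d\<in>?S \<inter> B'. d \<noteq> 0 \<and> ideal_of B' (span {d})"
    by (rule supersolvable_ideal_line[OF ss(2)])
  then obtain d a a' where d: "d \<in> B'" "d \<noteq> 0" "ideal_of B' (span {d})"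
    and aa': "d = a + a'" "a \<in> A" "a' \<in> A'" by blast
  have "a \<noteq> 0"
  proof
    assume "a = 0"
    hence "d \<in> A' \<inter> B'" using d aa' by simp
    with d(2) B'(3) show False unfolding direct_sum_def by blast
  qed
  \<comment> \<open>Components in \<open>A\<close> and \<open>A'\<close> are unique: the
    \<open>A\<close>-part of a multiple of \<open>d\<close> is the same multiple of
    \<open>a\<close>.\<close>
  have *: "u \<in> span {a}" if "u \<in> A" "v \<in> A'" "u + v \<in> span {d}" for u v
  proof -
    from that(3) obtain c where "u + v = c *s a + c *s a'"
      by (auto simp: span_singleton aa' scale_right_distrib)
    hence "u - c *s a = c *s a' - v" by (simp add: algebra_simps)
    moreover have "u - c *s a \<in> A" "c *s a' - v \<in> A'"
      using aa' that sA sA' by (auto intro!: subspace_diff subspace_scale)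
    ultimately have "u - c *s a \<in> A \<inter> A'" by simp
    hence "u - c *s a = 0" using I0 by blast
    hence "u = c *s a" by simp
    thus ?thesis by (auto simp: span_singleton)
  qed
  \<comment> \<open>Products between \<open>A\<close> and \<open>A'\<close> vanish, so only the
    \<open>B'\<close>-component of \<open>s\<close> matters, and \<open>B'\<close> stabilizes the
    line of \<open>d\<close>.\<close>
  have ida: "ideal_of UNIV (span {a})"
  proof (rule ideal_of_span_singleton)
    fix s
    obtain c b where s: "c \<in> A'" "b \<in> B'" "s = c + b" using direct_sumE[OF B'(3)] by metis
    have "a \<cdot> c \<in> A \<inter> A'" "c \<cdot> a \<in> A \<inter> A'" using s aa' idA idA' by (auto simp: ideal_of_def)
    hence "a \<cdot> c = 0" "c \<cdot> a = 0" using I0 by blast+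
    hence eq: "a \<cdot> s = a \<cdot> b" "s \<cdot> a = b \<cdot> a" by (simp_all add: s mult_simps)
    have "d \<cdot> b \<in> span {d}" "b \<cdot> d \<in> span {d}"
      using d(3) s(2) span_base[of d "{d}"] by (auto simp: ideal_of_def)
    hence d': "a \<cdot> b + a' \<cdot> b \<in> span {d}" "b \<cdot> a + b \<cdot> a' \<in> span {d}"
      by (simp_all add: aa'(1) mult_simps)
    have "a \<cdot> b \<in> A" "b \<cdot> a \<in> A" "a' \<cdot> b \<in> A'" "b \<cdot> a' \<in> A'"
      using aa' idA idA' by (auto simp: ideal_of_def)
    thus "a \<cdot> s \<in> span {a}" "s \<cdot> a \<in> span {a}"
      unfolding eq using *[OF _ _ d'(1)] *[OF _ _ d'(2)] by simp_all
  qed auto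
  moreover have "span {a} \<subseteq> A" using aa' sA by (intro span_minimal) auto
  moreover have "span {a} \<noteq> {0}" using \<open>a \<noteq> 0\<close> span_base[of a "{a}"] by auto
  ultimately have "span {a} = A" using A by (auto simp: minimal_ideal_def)
  with supersolvable_extension[of a B] ida \<open>a \<noteq> 0\<close> ss(1) B(3) nss show False by simp
qed

end

section \<open>Eigenvectors and a polynomial identity in characteristic \<open>p\<close>\<close>

text \<open>This is the Artin-Schreier polynomial \<open>X^p - X\<close>. Both sides of the first
  identity have \<open>X^p\<close>-coefficient \<open>1\<close> and vanish at the \<open>p\<close>
  distinct points \<open>-j\<close>, so they are the same polynomial. The second holds because
  Frobenius is additive and fixes the prime field.\<close>

lemma prod_of_nat_shift:
  fixes u :: "'f::field"
  assumes "CHAR('f) > 0"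
  shows "(\<Prod>j<CHAR('f). u + of_nat j) = u ^ CHAR('f) - u"
    and "(u + of_nat n) ^ CHAR('f) - (u + of_nat n) = u ^ CHAR('f) - u"
proof -
  let ?p = "CHAR('f)"
  have p: "prime ?p" using assms by (rule prime_CHAR_semidom)
  have fermat: "of_nat k ^ ?p = (of_nat k :: 'f)" for k
  proof (induction k)
    case 0 thus ?case using assms by simp
  next
    case (Suc k) thus ?case using freshmans_dream[OF p refl, of 1 "of_nat k :: 'f"] by simp
  qed
  show "(u + of_nat n) ^ ?p - (u + of_nat n) = u ^ ?p - u"
    by (simp add: freshmans_dream[OF p refl] fermat)
  define q where "q = (\<Prod>j<?p. [:of_nat j, 1 :: 'f:])"
  define r where "r = monom 1 ?p - monom (1::'f) 1"
  have p1: "?p > 1" using prime_gt_1_nat[OF p] .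
  have degq: "degree q = ?p" by (simp add: q_def degree_prod_sum_eq)
  have lcq: "lead_coeff q = 1" by (simp add: q_def lead_coeff_prod)
  have degr: "degree r \<le> ?p"
    unfolding r_def using p1 by (intro degree_diff_le) (auto simp: degree_monom_le order.trans[OF degree_monom_le])
  let ?A = "(\<lambda>j. - of_nat j :: 'f) ` {..<?p}"
  have "inj_on (\<lambda>j. - of_nat j :: 'f) {..<?p}"
  proof (rule linorder_inj_onI')
    fix i j assume "i \<in> {..<?p}" "j \<in> {..<?p}" "i < j"
    hence "\<not> ?p dvd (j - i)" by (auto dest: dvd_imp_le)
    thus "- of_nat i \<noteq> (- of_nat j :: 'f)"
      using of_nat_eq_iff_char_dvd[OF \<open>i < j\<close>, where ?'a = 'f] by simp
  qed
  hence card: "card ?A = ?p" by (simp add: card_image)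
  have "q = r"
  proof (rule poly_eqI_degree_lead_coeff)
    show "poly.coeff q ?p = poly.coeff r ?p" using lcq degq p1 by (simp add: r_def)
    show "poly q z = poly r z" if z: "z \<in> ?A" for z
    proof -
      obtain j where j: "j < ?p" "z = - of_nat j" using z by auto
      have "poly q z = 0" using j by (auto simp: q_def poly_prod prod_zero_iff)
      moreover have "z ^ ?p + of_nat j = 0"
        using freshmans_dream[OF p refl, of z "of_nat j"] p1 fermat[of j] j by (simp add: power_0_left)
      hence "z ^ ?p = z" using j by (simp only: add_eq_0_iff2)
      hence "poly r z = 0" by (simp add: r_def poly_monom)
      ultimately show ?thesis by simp
    qed
  qed (use card degq degr in auto)
  hence "poly q u = poly r u" by simp
  thus "(\<Prod>j<?p. u + of_nat j) = u ^ ?p - u"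
    by (simp add: q_def r_def poly_prod poly_monom add.commute)
qed

lemma of_int_mod_CHAR: "of_int (i mod int CHAR('f)) = (of_int i :: 'f::field)"
proof -
  have "int CHAR('f) dvd i mod int CHAR('f) - i" by (simp add: mod_eq_dvd_iff[symmetric])
  hence "of_int (i mod int CHAR('f) - i) = (0::'f)" by (simp only: of_int_eq_0_iff_char_dvd)
  thus ?thesis by simp
qed

section \<open>Eigenvectors for distinct eigenvalues\<close>

context vector_space
begin

text \<open>\<open>D\<close> is kept general because composites such as \<open>x \<circ> y\<close>
  are used as well. Applying \<open>D\<close> to a linear relation and subtracting
  \<open>ev j\<close> times the relation removes the vector \<open>f j\<close>, so induction on the
  index set applies. The injectivity of \<open>f\<close> transfers the result from indices to the
  image.\<close>

lemma eigenvectors_independent: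
  assumes D: "\<And>a b. D (a + b) = D a + D b" "\<And>k a. D (k *s a) = k *s D a"
    and I: "finite I" "inj_on ev I"
    and f: "\<And>i. i \<in> I \<Longrightarrow> f i \<noteq> 0" "\<And>i. i \<in> I \<Longrightarrow> D (f i) = ev i *s f i"
  shows "inj_on f I" "independent (f ` I)"
proof -
  show inj: "inj_on f I"
  proof (rule inj_onI)
    fix i j assume ij: "i \<in> I" "j \<in> I" "f i = f j"
    hence "ev i *s f i = ev j *s f i" using f(2) by metis
    hence "ev i = ev j" using f(1)[of i] ij by simp
    thus "i = j" using I(2) ij by (auto dest: inj_onD)
  qed
  have D_sum: "D (sum g J) = (\<Sum>i\<in>J. D (g i))" for g :: "'c \<Rightarrow> 'b" and J
    using D(1) D(2)[of 0 0] by (induction J rule: infinite_finite_induct) auto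
  have "\<forall>i\<in>J. u i = 0" if "finite J" "J \<subseteq> I" "(\<Sum>i\<in>J. u i *s f i) = 0" for u J
    using that
  proof (induction J arbitrary: u rule: finite_induct)
    case (insert j J)
    have 0: "(\<Sum>i\<in>J. u i *s f i) + u j *s f j = 0"
      using insert by (simp add: add.commute)
    hence "D ((\<Sum>i\<in>J. u i *s f i) + u j *s f j) = D 0" by simp
    moreover have "D 0 = 0" using D(2)[of 0 0] by simp
    moreover have "(\<Sum>i\<in>J. D (u i *s f i)) = (\<Sum>i\<in>J. (u i * ev i) *s f i)"
      using insert.prems f(2) by (intro sum.cong) (auto simp: D)
    ultimately have 1: "(\<Sum>i\<in>J. (u i * ev i) *s f i) + (u j * ev j) *s f j = 0"
      using insert.prems f(2)[of j] by (simp add: D D_sum)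
    have "ev j *s ((\<Sum>i\<in>J. u i *s f i) + u j *s f j) = 0" using 0 by simp
    hence "(\<Sum>i\<in>J. (u i * ev j) *s f i) + (u j * ev j) *s f j = 0"
      by (simp add: scale_right_distrib scale_sum_right mult.commute)
    with 1 have "(\<Sum>i\<in>J. (u i * ev i) *s f i) - (\<Sum>i\<in>J. (u i * ev j) *s f i) = 0"
      by (metis add_right_cancel diff_self)
    hence "(\<Sum>i\<in>J. (u i * (ev i - ev j)) *s f i) = 0"
      by (simp add: sum_subtractf[symmetric] scale_left_diff_distrib right_diff_distrib)
    hence *: "\<forall>i\<in>J. u i * (ev i - ev j) = 0"
      using insert.prems(1) by (intro insert.IH[of "\<lambda>i. u i * (ev i - ev j)"]) simp_all
    have J0: "\<forall>i\<in>J. u i = 0"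
    proof
      fix i assume i: "i \<in> J"
      hence "i \<noteq> j" "i \<in> I" "j \<in> I" using insert by auto
      hence "ev i \<noteq> ev j" using I(2) by (auto dest: inj_onD)
      thus "u i = 0" using * i by auto
    qed
    hence "u j *s f j = 0" using 0 by simp
    hence "u j = 0" using f(1)[of j] insert.prems by simp
    with J0 show ?case by simp
  qed simp
  note * = this[OF I(1) subset_refl]
  show "independent (f ` I)"
  proof (rule independent_if_scalars_zero)
    fix u x assume s: "(\<Sum>x\<in>f ` I. u x *s x) = 0" and x: "x \<in> f ` I"
    then obtain i where "i \<in> I" "x = f i" by blast
    moreover have "(\<Sum>i\<in>I. u (f i) *s f i) = 0" using s inj by (simp add: sum.reindex)
    ultimately show "u x = 0" using *[of "\<lambda>i. u (f i)"] by simp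
  qed (use I in simp)
qed

lemma span_doubleton: "u \<in> span {x, y} \<longleftrightarrow> (\<exists>k l. u = k *s x + l *s y)"
proof
  assume "u \<in> span {x, y}"
  then obtain k l where "u - k *s x = l *s y"
    unfolding span_breakdown_eq[of u x] by (auto simp: span_singleton)
  thus "\<exists>k l. u = k *s x + l *s y" by (metis add.commute diff_eq_eq)
qed (auto intro!: span_add span_scale intro: span_base)

lemma span_tripleton: "u \<in> span {x, y, z} \<longleftrightarrow> (\<exists>k l m. u = k *s x + l *s y + m *s z)"
proof
  assume "u \<in> span {x, y, z}"
  then obtain k l m where "u - k *s x = l *s y + m *s z"
    unfolding span_breakdown_eq[of u x] span_doubleton by auto
  hence "u = k *s x + l *s y + m *s z" by (simp add: algebra_simps)
  thus "\<exists>k l m. u = k *s x + l *s y + m *s z" by blast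
qed (auto intro!: span_add span_scale intro: span_base)

end

context finite_dimensional_vector_space
begin

text \<open>In characteristic 0 the eigenvalues are all distinct and would yield
  \<open>dimension + 1\<close> independent vectors. Nonvanishing is asked for in characteristic 0
  alone, since in the Heisenberg case it is first proved under that assumption.\<close>

lemma eigenvalue_ladder_CHAR_pos:
  fixes f :: "nat \<Rightarrow> 'b"
  assumes D: "\<And>a b. D (a + b) = D a + D b" "\<And>k a. D (k *s a) = k *s D a"
    and f: "\<And>n. CHAR('a) = 0 \<Longrightarrow> f n \<noteq> 0" "\<And>n. D (f n) = (\<alpha> + of_nat n) *s f n"
  shows "CHAR('a) > 0"
proof (rule ccontr)
  assume "\<not> CHAR('a) > 0"
  hence char0: "CHAR('a) = 0" by simp
  let ?I = "{..dimension}"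
  have inj: "inj_on (\<lambda>n. \<alpha> + of_nat n) ?I"
  proof (rule linorder_inj_onI')
    fix i j :: nat assume ij: "i < j"
    thus "\<alpha> + of_nat i \<noteq> \<alpha> + of_nat j"
      using of_nat_eq_iff_char_dvd[OF ij, where ?'a = 'a] char0 by simp
  qed
  note * = eigenvectors_independent[OF D _ inj f(1)[OF char0] f(2)]
  have "card (f ` ?I) \<le> dim (f ` ?I)"
    using independent_bound_general[OF *(2)] by simp
  also have "\<dots> \<le> dimension" by (rule dim_subset_UNIV)
  finally show False using card_image[OF *(1)] by simp
qed

end

section \<open>Irreducible faithful actions\<close>

context leibniz_algebra
begin

lemma funpow_mult_add: "((\<cdot>) x ^^ n) (a + b) = ((\<cdot>) x ^^ n) a + ((\<cdot>) x ^^ n) b"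
  by (induction n) (simp_all add: mult_simps)

lemma funpow_mult_scale: "((\<cdot>) x ^^ n) (k *s a) = k *s ((\<cdot>) x ^^ n) a"
  by (induction n) (simp_all add: mult_simps)

lemma funpow_mult_zero: "((\<cdot>) x ^^ n) 0 = 0"
  by (induction n) simp_all

text \<open>As operators, \<open>yx - xy = x\<close> gives \<open>y x^n - x^n y = n x^n\<close> by
  induction. Thus \<open>x\<close> raises an eigenvalue of \<open>y\<close> by one, and
  \<open>x^p\<close> commutes with \<open>y\<close> in characteristic \<open>p\<close>.\<close>

lemma funpow_mult_commutator:
  assumes "y \<cdot> x = x"
  shows "y \<cdot> ((\<cdot>) x ^^ n) a = ((\<cdot>) x ^^ n) (y \<cdot> a) + of_nat n *s ((\<cdot>) x ^^ n) a"
proof (induction n)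
  case (Suc n)
  show ?case
    using Suc assms leibniz[of y x "((\<cdot>) x ^^ n) a"]
    by (simp add: mult_simps algebra_simps)
qed simp

lemma subspace_mult_stable: "subspace W \<Longrightarrow> subspace {b. \<forall>w\<in>W. b \<cdot> w \<in> W}"
  by (rule subspaceI) (auto simp: mult_simps subspace_0 subspace_add subspace_scale)

lemma subspace_mult_scalar: "subspace {a. f a = k *s a}"
  if "\<And>a b. f (a + b) = f a + f b" "\<And>c a. f (c *s a) = c *s f a"
proof (rule subspaceI)
  have "f (0 *s 0) = 0 *s f 0" by (rule that)
  thus "0 \<in> {a. f a = k *s a}" by simp
qed (auto simp: that scale_right_distrib scale_left_commute)

text \<open>Only the residue \<open>p - 1\<close> needs an argument: there the next power is
  \<open>x^p\<close>, which returns to \<open>v\<close> and closes the cycle.\<close>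

lemma ladder_step:
  assumes "p > 0" "((\<cdot>) x ^^ p) v = v"
  shows "x \<cdot> ((\<cdot>) x ^^ nat (i mod int p)) v = ((\<cdot>) x ^^ nat ((i + 1) mod int p)) v"
proof (cases "i mod int p = int p - 1")
  case True
  hence "(i + 1) mod int p = 0" by (metis diff_add_cancel mod_add_left_eq mod_self)
  moreover have "Suc (nat (i mod int p)) = p" using True assms(1) by simp
  ultimately show ?thesis using assms(2) by (metis funpow.simps(2) funpow_0 nat_zero_as_int comp_apply of_nat_0)
next
  case False
  have "0 \<le> i mod int p" "i mod int p < int p" using assms(1) by auto
  hence "(i mod int p + 1) mod int p = i mod int p + 1" using False by simp
  hence "(i + 1) mod int p = i mod int p + 1" by (simp add: mod_add_left_eq)
  hence "nat ((i + 1) mod int p) = Suc (nat (i mod int p))" using assms(1) by (simp add: nat_add_distrib)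
  thus ?thesis by simp
qed

end

text \<open>What \<open>primitive_structure\<close> extracts from the hypotheses; the multiplication
  tables follow from these properties alone. \<open>common_eigenvector\<close> carries the
  supersolvability of the subalgebras \<open>A + S\<close> and replaces algebraic closedness of the
  field.\<close>

locale irreducible_pair = finite_dimensional_leibniz_algebra scale mult Basis
  for scale :: "'f::field \<Rightarrow> 'a::ab_group_add \<Rightarrow> 'a" (infixr \<open>*s\<close> 75)
    and mult :: "'a \<Rightarrow> 'a \<Rightarrow> 'a" (infixl \<open>\<cdot>\<close> 70)
    and Basis :: "'a set" +
  fixes A B :: "'a set"
  assumes sum: "direct_sum A B" and alg: "subalgebra B" and lieB: "lie B"
    and conv: "table_conventions A B"
    and act: "\<And>a b. a \<in> A \<Longrightarrow> b \<in> B \<Longrightarrow> b \<cdot> a \<in> A"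
    and irreducible: "\<And>W. subspace W \<Longrightarrow> W \<subseteq> A \<Longrightarrow> (\<And>b w. b \<in> B \<Longrightarrow> w \<in> W \<Longrightarrow> b \<cdot> w \<in> W) \<Longrightarrow>
      W \<noteq> {0} \<Longrightarrow> W = A"
    and faithful: "\<And>b. b \<in> B \<Longrightarrow> (\<And>a. a \<in> A \<Longrightarrow> b \<cdot> a = 0) \<Longrightarrow> b = 0"
    and common_eigenvector: "\<And>S W. subalgebra S \<Longrightarrow> S \<subset> B \<Longrightarrow> subspace W \<Longrightarrow> W \<subseteq> A \<Longrightarrow> W \<noteq> {0} \<Longrightarrow>
      (\<And>s w. s \<in> S \<Longrightarrow> w \<in> W \<Longrightarrow> s \<cdot> w \<in> W) \<Longrightarrow>
      \<exists>w\<in>W. w \<noteq> 0 \<and> (\<forall>s\<in>S. s \<cdot> w \<in> span {w})"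
    and dimA: "dim A > 1"
    and supersolvableB: "supersolvable B"
begin

lemma subspaceA: "subspace A" and subspaceB: "subspace B"
  using sum by (auto simp: direct_sum_def)

lemma nontrivialA: "A \<noteq> {0}"
  using dimA by auto

lemma squareB: "b \<in> B \<Longrightarrow> b \<cdot> b = 0"
  using lieB by (simp add: lie_def)

lemma antisymB: "b \<in> B \<Longrightarrow> c \<in> B \<Longrightarrow> b \<cdot> c = - (c \<cdot> b)"
  by (rule lie_antisym[OF subspaceB lieB])

lemma act_funpow: "a \<in> A \<Longrightarrow> x \<in> B \<Longrightarrow> ((\<cdot>) x ^^ n) a \<in> A"
  by (induction n) (simp_all add: act)

text \<open>Schur's argument: the eigenspace of \<open>f\<close> in \<open>A\<close> is nonzero and
  stable under \<open>B\<close>. The operator \<open>f\<close> may also be a power such as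
  \<open>x^p\<close> or \<open>y \<circ> y\<close>.\<close>

lemma scalar_of_eigenvector:
  assumes f: "\<And>a b. f (a + b) = f a + f b" "\<And>c a. f (c *s a) = c *s f a"
    and "\<And>a b. a \<in> A \<Longrightarrow> b \<in> B \<Longrightarrow> f (b \<cdot> a) = b \<cdot> f a"
    and "w \<in> A" "w \<noteq> 0" "f w = k *s w" "a \<in> A"
  shows "f a = k *s a"
proof -
  let ?W = "{a. f a = k *s a} \<inter> A"
  have "?W = A"
  proof (rule irreducible)
    show "subspace ?W" using f by (intro subspace_inter subspace_mult_scalar subspaceA)
    show "?W \<noteq> {0}" using assms by blast
  qed (use assms act in \<open>auto simp: mult_simps\<close>)
  thus ?thesis using assms by blast
qed

text \<open>Since \<open>xx = 0\<close>, the line of \<open>x\<close> is a proper subalgebra, to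
  which \<open>common_eigenvector\<close> applies; the eigenvalue lies in the base field.\<close>

lemma eigenvector:
  assumes "x \<in> B" "span {x} \<noteq> B"
  obtains w k where "w \<in> A" "w \<noteq> 0" "x \<cdot> w = k *s w"
proof -
  have "u \<cdot> v = 0" if "u \<in> span {x}" "v \<in> span {x}" for u v
    using that squareB[OF assms(1)] by (auto simp: span_singleton mult_simps)
  hence S: "subalgebra (span {x})" by (simp add: subalgebra_def span_zero)
  have sub: "span {x} \<subseteq> B" using assms(1) subspaceB by (intro span_minimal) auto
  have "\<exists>w\<in>A. w \<noteq> 0 \<and> (\<forall>s\<in>span {x}. s \<cdot> w \<in> span {w})"
    using assms(2) sub act by (intro common_eigenvector S subspaceA nontrivialA) auto
  then obtain w where w: "w \<in> A" "w \<noteq> 0" "x \<cdot> w \<in> span {w}"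
    using span_base[of x "{x}"] by blast
  thus thesis using that by (auto simp: span_singleton[of w])
qed

lemma central_scalar:
  assumes x: "x \<in> B" "\<And>b. b \<in> B \<Longrightarrow> x \<cdot> b = 0" and "span {x} \<noteq> B"
  obtains k where "\<forall>a\<in>A. x \<cdot> a = k *s a"
proof -
  obtain w k where w: "w \<in> A" "w \<noteq> 0" "x \<cdot> w = k *s w" using eigenvector assms by blast
  have "x \<cdot> a = k *s a" if "a \<in> A" for a
  proof (rule scalar_of_eigenvector[where f = "(\<cdot>) x" and w = w])
    show "x \<cdot> (b \<cdot> a) = b \<cdot> (x \<cdot> a)" if "b \<in> B" for a b
      using leibniz[of x b a] x(2)[OF that] by simp
  qed (simp_all add: mult_simps w that)
  thus thesis using that by blast
qed

text \<open>Otherwise every element of \<open>B\<close> acts on \<open>A\<close> as a scalar by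
  \<open>central_scalar\<close>, every line of \<open>A\<close> is stable, and irreducibility
  contradicts \<open>dim A > 1\<close>.\<close>

lemma abelian_line:
  assumes ab: "\<And>u v. u \<in> B \<Longrightarrow> v \<in> B \<Longrightarrow> u \<cdot> v = 0"
  obtains x where "x \<noteq> 0" "B = span {x}"
proof -
  have "\<exists>x\<in>B. span {x} = B"
  proof (rule ccontr)
    assume "\<not> ?thesis"
    hence ne: "span {x} \<noteq> B" if "x \<in> B" for x using that by blast
    have scalars: "b \<cdot> a \<in> span {a}" if b: "b \<in> B" and "a \<in> A" for a b
    proof -
      obtain k where "\<forall>a\<in>A. b \<cdot> a = k *s a"
        using central_scalar[OF b ab[OF b] ne[OF b]] by blast
      thus ?thesis using that by (auto simp: span_singleton)
    qed
    obtain w where w: "w \<in> A" "w \<noteq> 0" using subspace_nontrivial[OF subspaceA nontrivialA] by blast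
    have sub: "span {w} \<subseteq> A" using w subspaceA by (intro span_minimal) auto
    have "span {w} = A"
    proof (rule irreducible)
      show "b \<cdot> u \<in> span {w}" if "b \<in> B" "u \<in> span {w}" for b u
        using that scalars[OF that(1) w(1)] by (auto simp: span_singleton[of w] mult_simps)
      show "span {w} \<noteq> {0}" using w span_base[of w "{w}"] by auto
    qed (use sub in auto)
    hence "dim A = 1" using w(2) dim_span[of "{w}"] by simp
    thus False using dimA by simp
  qed
  then obtain x where x: "x \<in> B" "span {x} = B" by blast
  \<comment> \<open>For \<open>B = 0\<close> every line of \<open>A\<close> would be stable as
    well.\<close>
  have "x \<noteq> 0"
  proof
    assume "x = 0"
    hence B0: "B = {0}" using x by simp
    obtain w where w: "w \<in> A" "w \<noteq> 0" using subspace_nontrivial[OF subspaceA nontrivialA] by blast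
    have sub: "span {w} \<subseteq> A" using w subspaceA by (intro span_minimal) auto
    have "span {w} = A"
    proof (rule irreducible)
      show "span {w} \<noteq> {0}" using w span_base[of w "{w}"] by auto
    qed (use sub B0 in \<open>auto simp: span_zero\<close>)
    hence "dim A = 1" using w(2) dim_span[of "{w}"] by simp
    thus False using dimA by simp
  qed
  thus thesis using that x by blast
qed

lemma line_neq:
  assumes "u \<in> B" "v \<in> B" "u \<cdot> v \<noteq> 0" "b \<in> B"
  shows "span {b} \<noteq> B"
proof
  assume "span {b} = B"
  then obtain k l where "u = k *s b" "v = l *s b" using assms by (auto simp: span_singleton)
  thus False using assms squareB by (simp add: mult_simps)
qed

lemma stable_of_generators:
  assumes "span X = B" "subspace W" "\<And>x w. x \<in> X \<Longrightarrow> w \<in> W \<Longrightarrow> x \<cdot> w \<in> W" "b \<in> B" "w \<in> W"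
  shows "b \<cdot> w \<in> W"
proof -
  have "span X \<subseteq> {b. \<forall>w\<in>W. b \<cdot> w \<in> W}"
    using assms by (intro span_minimal subspace_mult_stable) auto
  thus ?thesis using assms by auto
qed

text \<open>The \<open>p\<close> eigenvalues \<alpha> + i of \<open>D\<close> are distinct, which
  gives independence; the span is stable under the spanning set \<open>X\<close> of
  \<open>B\<close>, so irreducibility makes it all of \<open>A\<close>.\<close>

lemma cyclic_basisI:
  assumes pos: "CHAR('f) > 0"
    and per: "\<And>i. e (i mod int CHAR('f)) = e i"
    and e: "\<And>i. e i \<in> A" "\<And>i. e i \<noteq> 0"
    and D: "\<And>a b. D (a + b) = D a + D b" "\<And>k a. D (k *s a) = k *s D a"
      "\<And>i. D (e i) = (\<alpha> + of_int i) *s e i"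
    and gen: "span X = B" "\<And>x i. x \<in> X \<Longrightarrow> x \<cdot> e i \<in> span (range e)"
  shows "cyclic_basis e A" and "span (range e) = A"
proof -
  let ?p = "int CHAR('f)"
  let ?I = "{1..?p}"
  have "inj_on (\<lambda>i. \<alpha> + of_int i) ?I"
  proof (rule linorder_inj_onI')
    fix i j assume ij: "i \<in> ?I" "j \<in> ?I" "i < j"
    hence "\<not> ?p dvd j - i" by (auto dest: zdvd_imp_le)
    hence "of_int (j - i) \<noteq> (0 :: 'f)" by (simp only: of_int_eq_0_iff_char_dvd not_False_eq_True)
    thus "\<alpha> + of_int i \<noteq> \<alpha> + of_int j" by simp
  qed
  note ind = eigenvectors_independent[where D = D and f = e, OF D(1,2) _ this e(2) D(3)]
  have range: "range e = e ` ?I"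
  proof (intro equalityI subsetI)
    fix u assume "u \<in> range e"
    then obtain i where i: "u = e i" by blast
    \<comment> \<open>Representatives are taken in \<open>1..p\<close> rather than
      \<open>0..p-1\<close>, to match the range in \<open>cyclic_basis\<close>.\<close>
    have "(1 + (i - 1) mod ?p) mod ?p = i mod ?p" by (simp add: mod_simps)
    hence "u = e (1 + (i - 1) mod ?p)" using per i by metis
    moreover have "0 \<le> (i - 1) mod ?p" "(i - 1) mod ?p < ?p" using pos by simp_all
    hence "1 + (i - 1) mod ?p \<in> ?I" unfolding atLeastAtMost_iff by linarith
    ultimately show "u \<in> e ` ?I" by blast
  qed auto
  show span: "span (range e) = A"
  proof (rule irreducible)
    show "span (range e) \<subseteq> A" using e subspaceA by (intro span_minimal) auto
    show "span (range e) \<noteq> {0}" using e(2)[of 0] span_base[of "e 0" "range e"] by auto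
    have "x \<cdot> w \<in> span (range e)" if x: "x \<in> X" and w: "w \<in> span (range e)" for x w
    proof -
      have "subspace {w. x \<cdot> w \<in> span (range e)}"
        by (rule subspaceI) (auto simp: mult_simps span_zero span_add span_scale)
      hence "span (range e) \<subseteq> {w. x \<cdot> w \<in> span (range e)}"
        using gen(2)[OF x] by (intro span_minimal) auto
      thus ?thesis using w by blast
    qed
    thus "b \<cdot> w \<in> span (range e)" if "b \<in> B" "w \<in> span (range e)" for b w
      using stable_of_generators[OF gen(1) _ _ that] by auto
  qed auto
  have "e (i + ?p) = e i" for i using per[of "i + ?p"] per[of i] by simp
  thus "cyclic_basis e A"
    using ind span range by (auto simp: cyclic_basis_def is_basis_def distinct_map)
qed

end

section \<open>The two nonabelian forms\<close>

context irreducible_pair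
begin

text \<open>The fixed vector \<open>w\<close> makes \<open>x^p\<close> the identity on
  \<open>A\<close>, so the powers of \<open>x\<close> applied to an eigenvector \<open>v\<close> of
  \<open>y\<close> run through a cycle of length \<open>p\<close>.\<close>

lemma form_a_normalized:
  assumes xy: "x \<in> B" "y \<in> B" "y \<cdot> x = x" "span {x, y} = B"
    and inj: "\<And>a. a \<in> A \<Longrightarrow> x \<cdot> a = 0 \<Longrightarrow> a = 0"
    and w: "w \<in> A" "w \<noteq> 0" "x \<cdot> w = w"
  shows "CHAR('f) > 0" "\<exists>e. cyclic_basis e A \<and> form_a A e"
proof -
  have x0: "x \<noteq> 0" using w by auto
  have ne: "span {b} \<noteq> B" if "b \<in> B" for b
    using line_neq[of y x b] xy x0 that by simp
  obtain v \<alpha> where v: "v \<in> A" "v \<noteq> 0" "y \<cdot> v = \<alpha> *s v"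
    using eigenvector[OF xy(2) ne[OF xy(2)]] by blast
  define g where "g n = ((\<cdot>) x ^^ n) v" for n
  have gA: "g n \<in> A" for n using v(1) xy(1) by (simp add: g_def act_funpow)
  have g0: "g n \<noteq> 0" for n
  proof (induction n)
    case 0 thus ?case using v by (simp add: g_def)
  next
    case (Suc n) thus ?case using inj[OF gA[of n]] by (auto simp: g_def)
  qed
  have yg: "y \<cdot> g n = (\<alpha> + of_nat n) *s g n" for n
    using funpow_mult_commutator[OF xy(3), of n v]
    by (simp add: g_def v(3) funpow_mult_scale scale_left_distrib)
  show pos: "CHAR('f) > 0"
    by (rule eigenvalue_ladder_CHAR_pos[where D = "(\<cdot>) y" and f = g and \<alpha> = \<alpha>])
      (simp_all add: mult_simps g0 yg)
  let ?p = "CHAR('f)"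
  let ?f = "(\<cdot>) x ^^ ?p"
  \<comment> \<open>\<open>x^p\<close> commutes with \<open>x\<close>, and with \<open>y\<close>
    because the commutator is \<open>p x^p = 0\<close>; as it fixes \<open>w\<close>, Schur's
    argument applies.\<close>
  have f_id: "?f a = a" if a: "a \<in> A" for a
  proof -
    have "?f a = 1 *s a"
    proof (rule scalar_of_eigenvector[where f = ?f and w = w])
      have "((\<cdot>) x ^^ n) w = w" for n by (induction n) (simp_all add: w)
      thus "?f w = 1 *s w" by simp
      fix a b assume "a \<in> A" "b \<in> B"
      then obtain k l where b: "b = k *s x + l *s y" using xy(4) span_doubleton by blast
      have "?f (y \<cdot> a) = y \<cdot> ?f a"
        using funpow_mult_commutator[OF xy(3), of ?p a] by simp
      moreover have "?f (x \<cdot> a) = x \<cdot> ?f a"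
        by (metis funpow_swap1)
      ultimately show "?f (b \<cdot> a) = b \<cdot> ?f a"
        by (simp add: b mult_simps funpow_mult_add funpow_mult_scale)
    qed (use w a in \<open>simp_all add: funpow_mult_add funpow_mult_scale\<close>)
    thus ?thesis by simp
  qed
  define e where "e i = g (nat (i mod int ?p))" for i
  have xe: "x \<cdot> e i = e (i + 1)" for i
    using ladder_step[OF pos f_id[OF v(1)], of i] by (simp add: e_def g_def)
  have ye: "y \<cdot> e i = (\<alpha> + of_int i) *s e i" for i
  proof -
    have "of_nat (nat (i mod int ?p)) = (of_int (i mod int ?p) :: 'f)"
      using pos by simp
    thus ?thesis by (simp add: e_def yg of_int_mod_CHAR)
  qed
  have cb: "cyclic_basis e A" "span (range e) = A"
  proof -
    have "e i \<in> span (range e)" for i by (simp add: span_base)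
    hence *: "x' \<cdot> e i \<in> span (range e)" if "x' \<in> {x, y}" for x' i
      using that by (auto simp: xe ye intro!: span_scale)
    show "cyclic_basis e A" "span (range e) = A"
      by (rule cyclic_basisI[where D = "(\<cdot>) y" and X = "{x, y}" and \<alpha> = \<alpha>];
          use pos gA g0 ye xy(4) * in \<open>simp add: e_def mult_simps\<close>)+
  qed
  have "y \<cdot> y = 0" "x \<cdot> x = 0" using squareB xy by auto
  hence "x \<notin> span {y}" using xy(3) x0 by (auto simp: span_singleton mult_simps)
  moreover have "y \<noteq> 0" using xy(3) x0 by auto
  ultimately have "independent {x, y}" "x \<noteq> y"
    by (auto simp: independent_insert span_base)
  hence basis: "is_basis [x, y] B" using xy(4) by (simp add: is_basis_def)
  have "\<exists>t. a = t ^ ?p - t" for a :: 'f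
  proof (cases "a = 0")
    case True thus ?thesis using pos by (intro exI[of _ 0]) (simp add: power_0_left)
  next
    case False
    \<comment> \<open>With \<open>s\<close> an eigenvalue of \<open>y + a x\<close> for the eigenvector \<open>u\<close>, the operators
      \<open>s + j - y\<close> with \<open>j < n\<close> multiply to \<open>P n\<close>, which maps \<open>u\<close> to \<open>a\<^sup>n x\<^sup>n u\<close>;
      for \<open>n = p\<close> it is a scalar that can be read off on the \<open>e i\<close>.\<close>
    have "y + a *s x \<in> B" using xy subspaceB by (auto intro: subspace_add subspace_scale)
    then obtain u s where u: "u \<in> A" "u \<noteq> 0" "(y + a *s x) \<cdot> u = s *s u"
      using eigenvector ne by metis
    define P where "P = rec_nat (\<lambda>c. c) (\<lambda>j h c. (s + of_nat j) *s h c - y \<cdot> h c)"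
    have P: "P 0 c = c" "P (Suc j) c = (s + of_nat j) *s P j c - y \<cdot> P j c" for j c
      by (simp_all add: P_def)
    have P_add: "P n (c + d) = P n c + P n d" for n c d
      by (induction n) (simp_all add: P mult_simps scale_right_distrib)
    have P_scale: "P n (k *s c) = k *s P n c" for n k c
      by (induction n) (simp_all add: P mult_simps scale_right_diff_distrib mult.commute)
    have yu: "y \<cdot> u = s *s u - a *s (x \<cdot> u)"
      using u(3) by (simp add: mult_simps algebra_simps)
    have Pu: "P n u = a ^ n *s ((\<cdot>) x ^^ n) u" for n
    proof (induction n)
      case (Suc n)
      have "((\<cdot>) x ^^ n) (x \<cdot> u) = x \<cdot> ((\<cdot>) x ^^ n) u" by (metis funpow_swap1)
      hence "y \<cdot> ((\<cdot>) x ^^ n) u = (s + of_nat n) *s ((\<cdot>) x ^^ n) u - a *s (x \<cdot> ((\<cdot>) x ^^ n) u)"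
        using funpow_mult_commutator[OF xy(3), of n u] funpow_mult_add[of n x "s *s u - a *s (x \<cdot> u)" "a *s (x \<cdot> u)"]
        by (simp add: yu funpow_mult_scale scale_left_distrib algebra_simps)
      thus ?case by (simp add: P Suc mult_simps scale_right_diff_distrib mult.commute)
    qed (simp add: P)
    have Pu: "P ?p u = a ^ ?p *s u" using Pu f_id[OF u(1)] by simp
    define K where "K = (s - \<alpha>) ^ ?p - (s - \<alpha>)"
    have Pe: "P n (e i) = (\<Prod>j<n. s - \<alpha> - of_int i + of_nat j) *s e i" for n i
      by (induction n) (simp_all add: P mult_simps ye scale_left_diff_distrib[symmetric] algebra_simps)
    \<comment> \<open>Changing \<open>i\<close> shifts the argument of \<open>c^p - c\<close> by an
      element of the prime field, which leaves its value unchanged. All \<open>e i\<close> therefore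
      share the eigenvalue \<open>K\<close>.\<close>
    have "P ?p (e i) = K *s e i" for i
    proof -
      have "(\<Prod>j<?p. s - \<alpha> - of_int i + of_nat j) = (s - \<alpha> - of_int i) ^ ?p - (s - \<alpha> - of_int i)"
        by (rule prod_of_nat_shift[OF pos])
      also have "of_int i = (of_nat (nat (i mod int ?p)) :: 'f)"
        using pos by (simp add: of_int_mod_CHAR)
      also have "(s - \<alpha> - of_nat (nat (i mod int ?p))) ^ ?p - (s - \<alpha> - of_nat (nat (i mod int ?p))) = K"
        using prod_of_nat_shift(2)[OF pos, of "s - \<alpha> - of_nat (nat (i mod int ?p))" "nat (i mod int ?p)"]
        by (simp add: K_def)
      finally show ?thesis by (simp add: Pe of_int_mod_CHAR)
    qed
    hence "span (range e) \<subseteq> {c. P ?p c = K *s c}"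
      using P_add P_scale by (intro span_minimal subspace_mult_scalar) auto
    hence "P ?p u = K *s u" using u cb by auto
    hence "K = a ^ ?p" using Pu u(2) by simp
    \<comment> \<open>The witness is t = s - \<alpha> - a: by additivity of Frobenius,
      \<open>t^p - t\<close> equals \<open>K - a^p + a\<close>, which is \<open>a\<close>.\<close>
    moreover have "(s - \<alpha> - a) ^ ?p = (s - \<alpha>) ^ ?p - a ^ ?p"
      using freshmans_dream[OF prime_CHAR_semidom[OF pos] refl, of "s - \<alpha> - a" a] by simp
    hence "(s - \<alpha> - a) ^ ?p - (s - \<alpha> - a) = K - a ^ ?p + a" by (simp add: K_def)
    ultimately show ?thesis by (metis diff_self add_0)
  qed
  hence "form_a A e"
    unfolding form_a_def using sum alg lieB basis xy(3) xe ye conv by blast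
  thus "\<exists>e. cyclic_basis e A \<and> form_a A e" using cb by blast
qed

text \<open>Since the line of \<open>x\<close> is an ideal, the kernel of \<open>x\<close> on
  \<open>A\<close> is stable under \<open>B\<close>, hence \<open>0\<close> by faithfulness. If
  \<open>x, y\<close> spanned a proper subalgebra, the commutator \<open>x\<close> would annihilate
  a common eigenvector. Dividing \<open>x\<close> by one of its eigenvalues then reaches the
  normalized situation.\<close>

lemma form_a_case:
  assumes xy: "x \<in> B" "x \<noteq> 0" "y \<in> B" "y \<cdot> x = x" and id: "\<And>b. b \<in> B \<Longrightarrow> b \<cdot> x \<in> span {x}"
  shows "CHAR('f) > 0 \<and> (\<exists>e. cyclic_basis e A \<and> form_a A e)"
proof -
  let ?K = "{a. x \<cdot> a = 0} \<inter> A"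
  have "subspace {a. x \<cdot> a = 0}" by (rule subspaceI) (simp_all add: mult_simps)
  hence sK: "subspace ?K" using subspaceA by (rule subspace_inter)
  have stable: "b \<cdot> a \<in> ?K" if b: "b \<in> B" and a: "a \<in> ?K" for b a
  proof -
    obtain k where "b \<cdot> x = k *s x" using id[OF b] by (auto simp: span_singleton)
    hence "x \<cdot> b = - (k *s x)" using antisymB[OF xy(1) b] by simp
    hence "x \<cdot> (b \<cdot> a) = 0" using leibniz[of x b a] a by (simp add: mult_simps)
    thus ?thesis using a b act by simp
  qed
  have "?K \<noteq> A" using faithful[OF xy(1)] xy(2) by blast
  hence "?K = {0}" using irreducible[OF sK _ stable] by blast
  hence inj: "a = 0" if "a \<in> A" "x \<cdot> a = 0" for a using that by blast
  have sub: "span {x, y} \<subseteq> B" using xy subspaceB by (intro span_minimal) auto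
  have gen: "span {x, y} = B"
  proof (rule ccontr)
    assume "span {x, y} \<noteq> B"
    hence psub: "span {x, y} \<subset> B" using sub by blast
    have "u \<cdot> v \<in> span {x, y}" if uv: "u \<in> span {x, y}" "v \<in> span {x, y}" for u v
    proof -
      obtain k l k' l' where *: "u = k *s x + l *s y" "v = k' *s x + l' *s y"
        using uv unfolding span_doubleton by blast
      have "x \<cdot> y = - x" using antisymB[OF xy(1,3)] xy(4) by simp
      hence "u \<cdot> v = (l * k' - k * l') *s x"
        using squareB xy by (simp add: * mult_simps scale_left_diff_distrib mult.commute)
      thus ?thesis by (simp add: span_scale span_base)
    qed
    hence "subalgebra (span {x, y})" by (simp add: subalgebra_def)
    then obtain w where w: "w \<in> A" "w \<noteq> 0" "\<forall>s\<in>span {x, y}. s \<cdot> w \<in> span {w}"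
      using common_eigenvector[OF _ psub subspaceA subset_refl nontrivialA] act sub by blast
    hence "x \<cdot> w \<in> span {w}" "y \<cdot> w \<in> span {w}" by (auto intro: span_base)
    then obtain k l where "x \<cdot> w = k *s w" "y \<cdot> w = l *s w"
      by (auto simp: span_singleton[of w])
    hence "x \<cdot> w = 0" using leibniz_left[of y x w] xy(4) by (simp add: mult_simps mult.commute)
    thus False using inj w by blast
  qed
  have "span {x} \<noteq> B" using line_neq[of y x x] xy by simp
  then obtain w \<mu> where w: "w \<in> A" "w \<noteq> 0" "x \<cdot> w = \<mu> *s w" using eigenvector[OF xy(1)] by blast
  hence \<mu>: "\<mu> \<noteq> 0" using inj by auto
  let ?x = "inverse \<mu> *s x"
  have "?x \<in> B" using xy subspaceB by (simp add: subspace_scale)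
  moreover have "y \<cdot> ?x = ?x" using xy by (simp add: mult_simps)
  moreover have "span {?x, y} = B"
  proof -
    have "x = \<mu> *s ?x" using \<mu> by simp
    hence "x \<in> span {?x, y}" by (metis span_base span_scale insertI1)
    moreover have "y \<in> span {?x, y}" by (simp add: span_base)
    ultimately have "span {x, y} \<subseteq> span {?x, y}" by (intro span_minimal) auto
    moreover have "span {?x, y} \<subseteq> B" using \<open>?x \<in> B\<close> xy subspaceB by (intro span_minimal) auto
    ultimately show ?thesis using gen by blast
  qed
  moreover have "a = 0" if "a \<in> A" "?x \<cdot> a = 0" for a
    using that \<mu> inj by (simp add: mult_simps)
  moreover have "?x \<cdot> w = w" using w \<mu> by (simp add: mult_simps)
  ultimately show ?thesis using form_a_normalized[of ?x y w] xy(3) w(1,2) by blast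
qed

text \<open>On a common eigenvector of \<open>x\<close> and \<open>y\<close> the commutator
  \<open>z\<close> would vanish, whereas it acts as \<open>1\<close>; so the span cannot be a proper
  subalgebra.\<close>

lemma heisenberg_generates:
  assumes B: "x \<in> B" "y \<in> B" "z \<in> B" and xyz: "y \<cdot> x = z" "x \<cdot> z = 0" "y \<cdot> z = 0"
    and z: "\<And>a. a \<in> A \<Longrightarrow> z \<cdot> a = a"
  shows "span {x, y, z} = B"
proof (rule ccontr)
  assume ne: "span {x, y, z} \<noteq> B"
  have sub: "span {x, y, z} \<subseteq> B" using B subspaceB by (intro span_minimal) auto
  hence psub: "span {x, y, z} \<subset> B" using ne by blast
  have xyz': "z \<cdot> x = 0" "z \<cdot> y = 0" "x \<cdot> y = - z" "x \<cdot> x = 0" "y \<cdot> y = 0" "z \<cdot> z = 0"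
    using antisymB[OF B(3,1)] antisymB[OF B(3,2)] antisymB[OF B(1,2)] xyz squareB B by simp_all
  have "u \<cdot> v \<in> span {x, y, z}" if uv: "u \<in> span {x, y, z}" "v \<in> span {x, y, z}" for u v
  proof -
    obtain k l m k' l' m' where *: "u = k *s x + l *s y + m *s z" "v = k' *s x + l' *s y + m' *s z"
      using uv unfolding span_tripleton by blast
    have "u \<cdot> v = (l * k' - k * l') *s z"
      by (simp add: * mult_simps xyz xyz' scale_left_diff_distrib mult.commute)
    thus ?thesis by (simp add: span_scale span_base)
  qed
  hence "subalgebra (span {x, y, z})" by (simp add: subalgebra_def)
  then obtain w where w: "w \<in> A" "w \<noteq> 0" "\<forall>s\<in>span {x, y, z}. s \<cdot> w \<in> span {w}"
    using common_eigenvector[OF _ psub subspaceA subset_refl nontrivialA] act sub by blast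
  hence "x \<cdot> w \<in> span {w}" "y \<cdot> w \<in> span {w}" by (auto intro: span_base)
  then obtain k l where "x \<cdot> w = k *s w" "y \<cdot> w = l *s w"
    by (auto simp: span_singleton[of w])
  hence "z \<cdot> w = 0" using leibniz_left[of y x w] xyz by (simp add: mult_simps mult.commute)
  thus False using z w by simp
qed

text \<open>Here \<open>yx - xy = 1\<close> on \<open>A\<close>, as for a derivation
  \<open>y\<close> and multiplication by a variable \<open>x\<close>. The ladder
  \<open>x^n v\<close> consists of eigenvectors of \<open>x \<circ> y\<close> with eigenvalue
  \<open>n\<close>.\<close>

lemma form_b_normalized:
  assumes B: "x \<in> B" "y \<in> B" "z \<in> B" and xyz: "y \<cdot> x = z" "x \<cdot> z = 0" "y \<cdot> z = 0"
    and z: "\<And>a. a \<in> A \<Longrightarrow> z \<cdot> a = a"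
    and w: "w \<in> A" "w \<noteq> 0" "x \<cdot> w = w" and v: "v \<in> A" "v \<noteq> 0" "y \<cdot> v = 0"
  shows "CHAR('f) > 0" "\<exists>e. cyclic_basis e A \<and> form_b A e"
proof -
  have gen: "span {x, y, z} = B" using assms by (intro heisenberg_generates)
  have z0: "z \<noteq> 0" using z[OF w(1)] w by auto
  have ne: "span {b} \<noteq> B" if "b \<in> B" for b
    using line_neq[of y x b] B xyz z0 that by simp
  have yx: "y \<cdot> (x \<cdot> a) = a + x \<cdot> (y \<cdot> a)" if "a \<in> A" for a
    using leibniz[of y x a] xyz z[OF that] by simp
  \<comment> \<open>For \<open>n = 0\<close> the truncated exponent \<open>n - 1\<close> is harmless
    because its coefficient is \<open>0\<close>.\<close>
  have comm: "y \<cdot> ((\<cdot>) x ^^ n) a = ((\<cdot>) x ^^ n) (y \<cdot> a) + of_nat n *s ((\<cdot>) x ^^ (n - 1)) a"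
    if a: "a \<in> A" for n a
  proof (induction n)
    case (Suc n)
    have "x \<cdot> (of_nat n *s ((\<cdot>) x ^^ (n - 1)) a) = of_nat n *s ((\<cdot>) x ^^ n) a"
      by (cases n) (simp_all add: mult_simps)
    thus ?case using Suc yx[OF act_funpow[OF a B(1), of n]]
      by (simp add: mult_simps scale_left_distrib algebra_simps)
  qed simp
  define g where "g n = ((\<cdot>) x ^^ n) v" for n
  have gA: "g n \<in> A" for n using v(1) B by (simp add: g_def act_funpow)
  have xg: "x \<cdot> g n = g (Suc n)" for n by (simp add: g_def)
  have yg: "y \<cdot> g n = of_nat n *s g (n - 1)" for n
    using comm[OF v(1), of n] by (simp add: g_def v(3) funpow_mult_zero)
  have xyg: "x \<cdot> (y \<cdot> g n) = of_nat n *s g n" for n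
    by (cases n) (simp_all add: yg mult_simps xg)
  show pos: "CHAR('f) > 0"
  proof (rule eigenvalue_ladder_CHAR_pos[where D = "\<lambda>a. x \<cdot> (y \<cdot> a)" and f = g and \<alpha> = 0])
    fix n assume char0: "CHAR('f) = 0"
    show "g n \<noteq> 0"
    proof (induction n)
      case 0 thus ?case using v by (simp add: g_def)
    next
      case (Suc n)
      \<comment> \<open>In characteristic 0, \<open>y\<close> leads back down the ladder with
        nonzero factors. The later proof of \<open>g0\<close> uses injectivity of \<open>x\<close>
        instead, available once \<open>x^p\<close> is known to be the identity.\<close>
      have "of_nat (Suc n) \<noteq> (0 :: 'f)" unfolding of_nat_eq_0_iff_char_dvd using char0 by simp
      hence "y \<cdot> g (Suc n) \<noteq> 0" unfolding yg using Suc by simp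
      thus ?case by auto
    qed
  qed (simp_all add: mult_simps xyg)
  let ?p = "CHAR('f)"
  let ?f = "(\<cdot>) x ^^ ?p"
  have f_id: "?f a = a" if a: "a \<in> A" for a
  proof -
    have "?f a = 1 *s a"
    proof (rule scalar_of_eigenvector[where f = ?f and w = w])
      have "((\<cdot>) x ^^ n) w = w" for n by (induction n) (simp_all add: w)
      thus "?f w = 1 *s w" by simp
      fix a b assume a: "a \<in> A" and "b \<in> B"
      then obtain k l m where b: "b = k *s x + l *s y + m *s z" using gen span_tripleton by blast
      have "?f (y \<cdot> a) = y \<cdot> ?f a" using comm[OF a, of ?p] by simp
      moreover have "?f (x \<cdot> a) = x \<cdot> ?f a" by (metis funpow_swap1)
      moreover have "?f (z \<cdot> a) = z \<cdot> ?f a" using z a act_funpow[OF a B(1)] by simp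
      ultimately show "?f (b \<cdot> a) = b \<cdot> ?f a"
        by (simp add: b mult_simps funpow_mult_add funpow_mult_scale)
    qed (use w a in \<open>simp_all add: funpow_mult_add funpow_mult_scale\<close>)
    thus ?thesis by simp
  qed
  have inj: "a = 0" if "a \<in> A" "x \<cdot> a = 0" for a
  proof -
    have "((\<cdot>) x ^^ Suc n) a = 0" for n using that(2) by (induction n) simp_all
    hence "?f a = 0" using pos by (metis Suc_pred)
    thus ?thesis using f_id that(1) by simp
  qed
  have g0: "g n \<noteq> 0" for n
  proof (induction n)
    case 0 thus ?case using v by (simp add: g_def)
  next
    case (Suc n) thus ?case using inj[OF gA[of n]] by (auto simp: g_def)
  qed
  \<comment> \<open>The shift by one puts \<open>v\<close> at index \<open>-1\<close>, so that
    \<open>y\<close> annihilates \<open>e (-1)\<close> and the coefficient in \<open>ye\<close>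
    becomes \<open>i + 1\<close>.\<close>
  define e where "e i = g (nat ((i + 1) mod int ?p))" for i
  have xe: "x \<cdot> e i = e (i + 1)" for i
    using ladder_step[OF pos f_id[OF v(1)], of "i + 1"] by (simp add: e_def g_def)
  have ye: "y \<cdot> e i = of_int (i + 1) *s e (i - 1)" for i
  proof -
    let ?n = "nat ((i + 1) mod int ?p)"
    have n: "of_nat ?n = (of_int (i + 1) :: 'f)"
      using pos of_int_mod_CHAR[of "i + 1", where ?'f = 'f] by simp
    show ?thesis
    proof (cases "?n = 0")
      \<comment> \<open>At the bottom of the ladder the coefficient vanishes in the field, so the
        truncated predecessor of \<open>0\<close> does not matter.\<close>
      case True
      hence "of_int (i + 1) = (0 :: 'f)" using n by (metis of_nat_0)
      thus ?thesis using True by (simp add: e_def yg del: of_int_add)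
    next
      case False
      have "((i + 1) mod int ?p - 1) mod int ?p = (i + 1) mod int ?p - 1"
        using pos False pos_mod_bound[of "int ?p" "i + 1"]
        by (intro mod_pos_pos_trivial) linarith+
      hence "i mod int ?p = (i + 1) mod int ?p - 1" by (simp add: mod_simps)
      hence "?n - 1 = nat (i mod int ?p)" by simp
      thus ?thesis by (simp only: e_def yg n) simp
    qed
  qed
  have ze: "z \<cdot> e i = e i" for i using z gA by (simp add: e_def)
  have cb: "cyclic_basis e A" "span (range e) = A"
  proof -
    have "e i \<in> span (range e)" for i by (simp add: span_base)
    hence *: "x' \<cdot> e i \<in> span (range e)" if "x' \<in> {x, y, z}" for x' i
      using that by (auto simp: xe ye ze simp del: of_int_add intro!: span_scale)
    have **: "x \<cdot> (y \<cdot> e i) = (1 + of_int i) *s e i" for i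
      by (simp add: ye xe mult_simps add.commute)
    have per: "e (i mod int ?p) = e i" for i by (simp add: e_def mod_simps)
    show "cyclic_basis e A" "span (range e) = A"
      by (rule cyclic_basisI[where D = "\<lambda>a. x \<cdot> (y \<cdot> a)" and X = "{x, y, z}" and \<alpha> = 1];
          use pos gA g0 per ** gen * in \<open>simp add: mult_simps\<close>; simp add: e_def gA g0)+
  qed
  have sq: "y \<cdot> y = 0" "x \<cdot> x = 0" using squareB B by auto
  have zx: "z \<cdot> x = 0" using antisymB[OF B(3,1)] xyz by simp
  have "y \<notin> span {z}"
  proof
    assume "y \<in> span {z}"
    then obtain k where "y = k *s z" by (auto simp: span_singleton)
    hence "y \<cdot> x = 0" using zx by (simp add: mult_simps)
    thus False using xyz(1) z0 by simp
  qed
  moreover have "x \<notin> span {y, z}"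
  proof
    assume "x \<in> span {y, z}"
    then obtain k l where "x = k *s y + l *s z" by (auto simp: span_doubleton)
    hence "y \<cdot> x = 0" using sq xyz(3) by (simp add: mult_simps)
    thus False using xyz(1) z0 by simp
  qed
  ultimately have "independent {x, y, z}" "x \<noteq> y" "x \<noteq> z" "y \<noteq> z"
    using z0 by (auto simp: independent_insert span_base)
  hence basis: "is_basis [x, y, z] B" using gen by (simp add: is_basis_def)
  have "perfect_field TYPE('f)" if p2: "?p = 2"
  proof -
    have two: "2 = (0 :: 'f)" using p2 of_nat_CHAR[where ?'a = 'f] by simp
    \<comment> \<open>In characteristic 2 the commutator of \<open>y^2\<close> with \<open>x\<close>
      is \<open>2y = 0\<close>, so \<open>y^2\<close> is a scalar, and it is \<open>0\<close>
      because \<open>y\<close> annihilates \<open>v\<close>.\<close>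
    have yy: "y \<cdot> (y \<cdot> a) = 0" if a: "a \<in> A" for a
    proof -
      have "y \<cdot> (y \<cdot> a) = 0 *s a"
      proof (rule scalar_of_eigenvector[where f = "\<lambda>a. y \<cdot> (y \<cdot> a)" and w = v])
        fix a b assume a: "a \<in> A" and "b \<in> B"
        then obtain k l m where b: "b = k *s x + l *s y + m *s z" using gen span_tripleton by blast
        have "y \<cdot> (y \<cdot> (x \<cdot> a)) = (1 + 1) *s (y \<cdot> a) + x \<cdot> (y \<cdot> (y \<cdot> a))"
          using yx[OF a] yx[OF act[OF a B(2)]] by (simp only: mult_simps scale_left_distrib) simp
        hence "y \<cdot> (y \<cdot> (x \<cdot> a)) = x \<cdot> (y \<cdot> (y \<cdot> a))" using two by simp
        thus "y \<cdot> (y \<cdot> (b \<cdot> a)) = b \<cdot> (y \<cdot> (y \<cdot> a))"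
          using z a act B by (simp add: b mult_simps)
      qed (use a v in \<open>simp_all add: mult_simps\<close>)
      thus ?thesis by simp
    qed
    have "\<exists>b. b ^ ?p = a" for a :: 'f
    proof -
      have "y + a *s x \<in> B" using B subspaceB by (auto intro: subspace_add subspace_scale)
      then obtain u s where u: "u \<in> A" "u \<noteq> 0" "(y + a *s x) \<cdot> u = s *s u"
        using eigenvector ne by metis
      have "x \<cdot> (x \<cdot> u) = u" using f_id[OF u(1)] p2 by (simp add: numeral_2_eq_2)
      \<comment> \<open>From \<open>x^2 = 1\<close>, \<open>y^2 = 0\<close> and
        \<open>yx = 1 + xy\<close>, the square of \<open>y + ax\<close> is \<open>a + a^2\<close>
        plus \<open>2a xy\<close>, which vanishes. Hence \<open>s^2 = a + a^2\<close>, and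
        \<open>s + a\<close> is a square root of \<open>a\<close>.\<close>
      hence "(y + a *s x) \<cdot> ((y + a *s x) \<cdot> u) = a *s u + (a *s (x \<cdot> (y \<cdot> u)) + a *s (x \<cdot> (y \<cdot> u))) + (a * a) *s u"
        using yx[OF u(1)] yy[OF u(1)]
        by (simp add: mult_simps scale_left_distrib scale_right_distrib add_ac)
      moreover have "a + a = 2 * a" by (rule mult_2[symmetric])
      hence "a + a = 0" by (simp only: two mult_zero_left)
      hence "a *s q + a *s q = 0" for q by (simp only: scale_left_distrib[symmetric] scale_zero_left)
      moreover have "(y + a *s x) \<cdot> ((y + a *s x) \<cdot> u) = (s * s) *s u"
        by (simp only: u(3) mult_scale_right scale_scale)
      ultimately have "(s * s) *s u = (a + a * a) *s u"
        by (simp only: scale_left_distrib add_0_right)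
      hence "s * s = a + a * a" using u(2) by simp
      hence "(s + a) ^ ?p = a + 2 * (a * a + s * a)"
        unfolding p2 by (simp add: power2_eq_square algebra_simps)
      thus ?thesis using two by auto
    qed
    thus ?thesis by (simp add: perfect_field_def)
  qed
  hence "form_b A e"
    unfolding form_b_def using sum alg lieB basis xyz xe ye ze conv by blast
  thus "\<exists>e. cyclic_basis e A \<and> form_b A e" using cb by blast
qed

text \<open>Adding multiples of \<open>z\<close> leaves the brackets unchanged and shifts
  eigenvalues freely, as \<open>z\<close> acts by \<open>1\<close>: that of \<open>x\<close> on
  \<open>w\<close> becomes \<open>1\<close> and that of \<open>y\<close> on \<open>v\<close> becomes
  \<open>0\<close>.\<close>

lemma form_b_case:
  assumes B: "x \<in> B" "y \<in> B" "z \<in> B" and xyz: "y \<cdot> x = z" "x \<cdot> z = 0" "y \<cdot> z = 0"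
    and z: "\<And>a. a \<in> A \<Longrightarrow> z \<cdot> a = a"
  shows "CHAR('f) > 0 \<and> (\<exists>e. cyclic_basis e A \<and> form_b A e)"
proof -
  have z0: "z \<noteq> 0" using z subspace_nontrivial[OF subspaceA nontrivialA] by auto
  have ne: "span {b} \<noteq> B" if "b \<in> B" for b
    using line_neq[of y x b] B xyz z0 that by simp
  obtain w \<mu> where w: "w \<in> A" "w \<noteq> 0" "x \<cdot> w = \<mu> *s w" using eigenvector[OF B(1) ne[OF B(1)]] by blast
  obtain v \<nu> where v: "v \<in> A" "v \<noteq> 0" "y \<cdot> v = \<nu> *s v" using eigenvector[OF B(2) ne[OF B(2)]] by blast
  let ?x = "x + (1 - \<mu>) *s z" and ?y = "y - \<nu> *s z"
  have zx: "z \<cdot> x = 0" "z \<cdot> z = 0" using antisymB[OF B(3,1)] xyz squareB B by simp_all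
  have "?x \<in> B" "?y \<in> B" using B subspaceB by (auto intro: subspace_add subspace_diff subspace_scale)
  moreover have "?y \<cdot> ?x = z" "?x \<cdot> z = 0" "?y \<cdot> z = 0" by (simp_all add: mult_simps xyz zx)
  moreover have "?x \<cdot> w = w" "?y \<cdot> v = 0"
    using w v z by (simp_all add: mult_simps scale_left_diff_distrib)
  ultimately show ?thesis
    using form_b_normalized[of ?x ?y z w v] B z w v by blast
qed

text \<open>A noncentral ideal line of \<open>B\<close> gives form (a). Otherwise the bottom of the
  supersolvable chain of \<open>B\<close> is a central line, which acts by scalars, and the second
  term of the chain supplies the \<open>x\<close> of form (b).\<close>

lemma forms_of_nonabelian:
  assumes "u \<in> B" "v \<in> B" "u \<cdot> v \<noteq> 0"
  shows "CHAR('f) > 0 \<and> (\<exists>e. cyclic_basis e A \<and> (form_a A e \<or> form_b A e))"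
proof (cases "\<exists>x\<in>B. \<exists>b\<in>B. ideal_of B (span {x}) \<and> b \<cdot> x \<noteq> 0")
  case True
  then obtain x b where x: "x \<in> B" "b \<in> B" "ideal_of B (span {x})" "b \<cdot> x \<noteq> 0" by blast
  have id: "c \<cdot> x \<in> span {x}" if "c \<in> B" for c
    using ideal_of_mult_left[OF x(3) that] span_base[of x "{x}"] by simp
  then obtain k where k: "b \<cdot> x = k *s x" using x by (auto simp: span_singleton)
  have "inverse k *s b \<in> B" using x subspaceB by (simp add: subspace_scale)
  moreover have "(inverse k *s b) \<cdot> x = x" using k x by (auto simp: mult_simps)
  moreover have "x \<noteq> 0" using x by auto
  ultimately show ?thesis using form_a_case[of x "inverse k *s b"] x id by blast
next
  case False
  hence central: "b \<cdot> x = 0" if "x \<in> B" "b \<in> B" "ideal_of B (span {x})" for x b using that by blast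
  have ne: "span {b} \<noteq> B" if "b \<in> B" for b using line_neq assms that by blast
  obtain n I where I: "I 0 = {0}" "I n = B" "\<forall>i<n. I i \<subset> I (Suc i)"
    "\<forall>i\<le>n. ideal_of B (I i) \<and> dim (I i) = i"
    using supersolvableB unfolding supersolvable_def by blast
  have step: "\<exists>x. x \<notin> I i \<and> I (Suc i) = span (insert x (I i))" if "i < n" for i
  proof -
    have id: "ideal_of B (I i)" "ideal_of B (I (Suc i))" and "dim (I i) = i" "dim (I (Suc i)) = Suc i"
      and "I i \<subset> I (Suc i)"
      using I(3,4) that by auto
    then obtain x where "x \<notin> I i" "x \<in> I (Suc i)" by blast
    thus ?thesis using codim_one_span[OF ideal_of_subspace[OF id(1)] ideal_of_subspace[OF id(2)]]
      \<open>I i \<subset> I (Suc i)\<close> \<open>dim (I i) = i\<close> \<open>dim (I (Suc i)) = Suc i\<close> by auto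
  qed
  have n0: "0 < n"
  proof (rule ccontr)
    assume "\<not> 0 < n"
    hence "B = {0}" using I(1,2) by simp
    thus False using ne[of 0] by simp
  qed
  obtain z0 where z0: "I 1 = span {z0}" "z0 \<noteq> 0"
  proof -
    obtain z0 where "z0 \<noteq> 0" "I 1 = span (insert z0 {0})" using step[OF n0] I(1) by auto
    moreover have "span (insert z0 {0}) = span {z0}" by (simp add: insert_commute)
    ultimately show thesis using that by simp
  qed
  have "ideal_of B (I 1)" using I(4) n0 by auto
  hence idz0: "ideal_of B (span {z0})" using z0 by simp
  have z0B: "z0 \<in> B" using ideal_of_subset[OF idz0] span_base[of z0 "{z0}"] by auto
  have z0b: "b \<cdot> z0 = 0" "z0 \<cdot> b = 0" if "b \<in> B" for b
    using central[OF z0B that idz0] antisymB[OF z0B that] by auto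
  obtain c where c: "\<forall>a\<in>A. z0 \<cdot> a = c *s a"
    using central_scalar[OF z0B z0b(2) ne[OF z0B]] by blast
  hence c0: "c \<noteq> 0" using faithful[OF z0B] z0 by auto
  define z where "z = inverse c *s z0"
  have zB: "z \<in> B" using z0B subspaceB by (simp add: z_def subspace_scale)
  have z: "z \<cdot> a = a" if "a \<in> A" for a using c c0 that by (simp add: z_def mult_simps)
  have bz: "b \<cdot> z = 0" "z \<cdot> b = 0" if "b \<in> B" for b using z0b[OF that] by (simp_all add: z_def mult_simps)
  have "z0 = c *s z" using c0 by (simp add: z_def)
  hence "z0 \<in> span {z}" by (metis span_base span_scale singletonI)
  moreover have "z \<in> span {z0}" by (simp add: z_def span_base span_scale)
  ultimately have "span {z0} = span {z}" unfolding span_eq by simp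
  hence I1: "I 1 = span {z}" using z0 by simp
  \<comment> \<open>A central element acts by a scalar, as does a suitable multiple of
    \<open>z\<close>; faithfulness identifies the two.\<close>
  have center: "x \<in> span {z}" if x: "x \<in> B" "\<And>b. b \<in> B \<Longrightarrow> b \<cdot> x = 0" for x
  proof -
    have "x \<cdot> b = 0" if "b \<in> B" for b using x that antisymB[OF x(1) that] by simp
    then obtain k where k: "\<forall>a\<in>A. x \<cdot> a = k *s a" using central_scalar[OF x(1) _ ne[OF x(1)]] by blast
    have "x - k *s z = 0"
    proof (rule faithful)
      show "x - k *s z \<in> B" using x zB subspaceB by (auto intro: subspace_diff subspace_scale)
    qed (use k z in \<open>simp add: mult_simps\<close>)
    hence "x = k *s z" by simp
    thus ?thesis by (auto simp: span_singleton)
  qed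
  have "n \<noteq> 1" using I(2) I1 ne[OF zB] by auto
  hence n1: "1 < n" using n0 by simp
  obtain x where x: "x \<notin> span {z}" "I 2 = span {x, z}"
  proof -
    obtain x where "x \<notin> I 1" "I 2 = span (insert x (span {z}))"
      using step[OF n1] I1 by (auto simp: numeral_2_eq_2)
    moreover have "span (insert x (span {z})) = span {x, z}"
      using span_Un[of "{x}" "span {z}"] span_Un[of "{x}" "{z}"] by (simp add: span_span insert_commute)
    ultimately show thesis using that I1 by auto
  qed
  have idI2: "ideal_of B (span {x, z})" using I(4) n1 x(2) by (metis Suc_leI numeral_2_eq_2 One_nat_def)
  have xB: "x \<in> B" using ideal_of_subset[OF idI2] span_base[of x "{x, z}"] by auto
  \<comment> \<open>If this fails, \<open>x' = bx\<close> is fixed by a multiple \<open>b'\<close>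
    of \<open>b\<close>. Its line is not central and hence not an ideal, so some \<open>k\<close>
    maps \<open>x'\<close> to a vector with nonzero \<open>z\<close>-component; correcting
    \<open>k\<close> by \<open>b'\<close> yields a \<open>y\<close> with
    \<open>yx' = z\<close>.\<close>
  have bx_z: "b \<cdot> x \<in> span {z}" if b: "b \<in> B" for b
  proof (rule ccontr)
    assume nz: "b \<cdot> x \<notin> span {z}"
    have "b \<cdot> x \<in> span {x, z}" using ideal_of_mult_left[OF idI2 b] by (simp add: span_base)
    then obtain l m where bx: "b \<cdot> x = l *s x + m *s z" unfolding span_doubleton by blast
    with nz have l0: "l \<noteq> 0" by (auto simp: span_singleton)
    define x' where "x' = b \<cdot> x"
    define b' where "b' = inverse l *s b"
    have b'B: "b' \<in> B" using b subspaceB by (simp add: b'_def subspace_scale)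
    have x'B: "x' \<in> B" using subalgebra_mult[OF alg b xB] by (simp add: x'_def)
    have b'x': "b' \<cdot> x' = x'"
    proof -
      have "b \<cdot> x' = l *s x'" using bz(1)[OF b] by (simp add: x'_def bx mult_simps scale_right_distrib)
      thus ?thesis using l0 by (simp add: b'_def mult_simps)
    qed
    have "x' \<noteq> 0" using nz span_zero by (auto simp: x'_def)
    hence "\<not> ideal_of B (span {x'})" using central[OF x'B b'B] b'x' by auto
    moreover have "x' \<cdot> s \<in> span {x'}" if "s \<in> B" "s \<cdot> x' \<in> span {x'}" for s
      using antisymB[OF x'B that(1)] that(2) by (simp add: span_neg)
    ultimately obtain k where k: "k \<in> B" "k \<cdot> x' \<notin> span {x'}"
      using ideal_of_span_singleton[OF subspaceB x'B] by blast
    have "x' \<in> span {x, z}" unfolding span_doubleton x'_def bx by blast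
    hence "k \<cdot> x' \<in> span {x, z}" using ideal_of_mult_left[OF idI2 k(1)] by simp
    then obtain l1 m1 where kx': "k \<cdot> x' = l1 *s x + m1 *s z" unfolding span_doubleton by blast
    have xx': "x = inverse l *s x' - (inverse l * m) *s z"
      using l0 by (simp add: x'_def bx scale_right_distrib)
    define l2 where "l2 = l1 * inverse l"
    define m2 where "m2 = m1 - l1 * inverse l * m"
    have kx'2: "k \<cdot> x' = l2 *s x' + m2 *s z"
      unfolding kx' by (subst xx') (simp add: l2_def m2_def scale_right_diff_distrib scale_left_diff_distrib algebra_simps)
    have m20: "m2 \<noteq> 0" using k(2) kx'2 by (auto simp: span_singleton)
    define y where "y = inverse m2 *s (k - l2 *s b')"
    have yB: "y \<in> B" using k(1) b'B subspaceB by (simp add: y_def subspace_scale subspace_diff)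
    have yx': "y \<cdot> x' = z" using m20 by (simp add: y_def mult_simps kx'2 b'x')
    \<comment> \<open>In the resulting Heisenberg algebra all products with \<open>x'\<close> lie in
      the line of \<open>z\<close>, contradicting \<open>b'x' = x'\<close>.\<close>
    have "span {x', y, z} = B"
      using x'B yB zB yx' bz z by (intro heisenberg_generates) auto
    then obtain p q r where "b' = p *s x' + q *s y + r *s z"
      using b'B span_tripleton by blast
    hence "b' \<cdot> x' = q *s z" using squareB[OF x'B] bz x'B yx' by (simp add: mult_simps)
    hence "x' \<in> span {z}" using b'x' by (auto simp: span_singleton)
    thus False using nz by (simp add: x'_def)
  qed
  obtain b where b: "b \<in> B" "b \<cdot> x \<noteq> 0" using center[OF xB] x(1) by blast
  then obtain k where k: "b \<cdot> x = k *s z" using bx_z by (auto simp: span_singleton)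
  let ?y = "inverse k *s b"
  have "k \<noteq> 0" using b k by auto
  hence "?y \<cdot> x = z" using k by (simp add: mult_simps)
  moreover have "?y \<in> B" using b subspaceB by (simp add: subspace_scale)
  ultimately have "CHAR('f) > 0 \<and> (\<exists>e. cyclic_basis e A \<and> form_b A e)"
    using xB zB bz z by (intro form_b_case[of x ?y z])
  thus ?thesis by blast
qed

end

section \<open>The structure of the algebra\<close>

context irreducible_pair
begin

lemma multA: "a \<in> A \<Longrightarrow> a' \<in> A \<Longrightarrow> a \<cdot> a' = 0"
  and mult_right_act: "a \<in> A \<Longrightarrow> b \<in> B \<Longrightarrow> a \<cdot> b = (if lie UNIV then - (b \<cdot> a) else 0)"
  using conv by (auto simp: table_conventions_def)

lemma mult_left_A:
  assumes "a \<in> A"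
  shows "u \<cdot> a \<in> A"
proof -
  obtain a' b where "a' \<in> A" "b \<in> B" "u = a' + b" using direct_sumE[OF sum] by metis
  thus ?thesis using assms multA[of a' a] act[of a b] by (simp add: mult_simps)
qed

text \<open>Let \<open>N\<close> be the square of the algebra. The last term of its lower central
  series meeting \<open>A\<close> nontrivially contains a nonzero vector of \<open>A\<close>
  annihilated by \<open>N\<close>. All such vectors form a \<open>B\<close>-stable subspace, since
  \<open>m(ba) = (mb)a + b(ma)\<close>, so \<open>N\<close> annihilates \<open>A\<close> and
  faithfulness forces \<open>uv = 0\<close>.\<close>

lemma abelian_of_strongly_solvable:
  assumes "strongly_solvable UNIV" "u \<in> B" "v \<in> B"
  shows "u \<cdot> v = 0"
proof (rule ccontr)
  assume uv: "u \<cdot> v \<noteq> 0"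
  let ?N = "product_space UNIV UNIV"
  have N: "a \<cdot> b \<in> ?N" for a b by (rule mult_in_product_space) auto
  have uvB: "u \<cdot> v \<in> B" using alg assms by (simp add: subalgebra_mult)
  define P where "P k \<longleftrightarrow> (\<exists>w\<in>A. w \<in> lower_central_series ?N k \<and> w \<noteq> 0)" for k
  obtain a where "a \<in> A" "(u \<cdot> v) \<cdot> a \<noteq> 0" using faithful[OF uvB] uv by blast
  hence "P 0" using N mult_left_A unfolding P_def by (intro bexI[of _ "(u \<cdot> v) \<cdot> a"]) auto
  moreover obtain n where "lower_central_series ?N n = {0}"
    using assms(1) by (auto simp: strongly_solvable_def nilpotent_def)
  hence "\<not> P n" by (simp add: P_def)
  ultimately obtain k where k: "P k" "\<not> P (Suc k)" by (metis nat_induct)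
  then obtain w where w: "w \<in> A" "w \<in> lower_central_series ?N k" "w \<noteq> 0" by (auto simp: P_def)
  have mw: "m \<cdot> w = 0" if "m \<in> ?N" for m
  proof -
    have "m \<cdot> w \<in> lower_central_series ?N (Suc k)"
      using mult_in_product_space[OF that w(2)] by simp
    thus ?thesis using k(2) mult_left_A[OF w(1)] unfolding P_def by blast
  qed
  let ?W = "{a \<in> A. \<forall>m\<in>?N. m \<cdot> a = 0}"
  have "?W = A"
  proof (rule irreducible)
    show "subspace ?W"
      using subspaceA by (intro subspaceI) (auto simp: mult_simps subspace_0 subspace_add subspace_scale)
    show "?W \<noteq> {0}" using w mw by blast
    fix b a assume b: "b \<in> B" and a: "a \<in> ?W"
    have "m \<cdot> (b \<cdot> a) = 0" if "m \<in> ?N" for m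
      using leibniz[of m b a] a N that by simp
    thus "b \<cdot> a \<in> ?W" using a mult_left_A by simp
  qed auto
  hence "(u \<cdot> v) \<cdot> a = 0" if "a \<in> A" for a using that N by blast
  with faithful[OF uvB] uv show False by blast
qed

text \<open>All products then lie in \<open>A\<close>, which is abelian, so the lower central series
  of the square vanishes after one step.\<close>

lemma strongly_solvable_of_abelian:
  assumes ab: "\<And>u v. u \<in> B \<Longrightarrow> v \<in> B \<Longrightarrow> u \<cdot> v = 0"
  shows "strongly_solvable UNIV"
proof -
  let ?N = "product_space UNIV UNIV"
  have "?N \<subseteq> A"
  proof (rule product_space_subset[OF subspaceA])
    fix u v
    obtain a b where u: "a \<in> A" "b \<in> B" "u = a + b" using direct_sumE[OF sum] by metis
    obtain a' b' where v: "a' \<in> A" "b' \<in> B" "v = a' + b'" using direct_sumE[OF sum] by metis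
    have "a \<cdot> b' \<in> A"
      using mult_right_act u v act subspaceA by (simp add: subspace_neg subspace_0)
    thus "u \<cdot> v \<in> A"
      using act[of a' b] multA[of a a'] ab[of b b'] u v subspaceA by (simp add: mult_simps subspace_add)
  qed
  hence "product_space ?N ?N \<subseteq> {0}"
    using multA by (intro product_space_subset) auto
  hence "lower_central_series ?N (Suc 0) = {0}"
    using subspace_0[OF subspace_product_space] by auto
  thus ?thesis unfolding strongly_solvable_def nilpotent_def by blast
qed

lemma form_strongly_solvable_of_strongly_solvable:
  assumes "strongly_solvable UNIV"
  shows "form_strongly_solvable A"
proof -
  obtain x where "x \<noteq> 0" "B = span {x}"
    using abelian_line abelian_of_strongly_solvable[OF assms] by metis
  thus ?thesis
    using dimA sum alg lieB conv unfolding form_strongly_solvable_def by auto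
qed

end

section \<open>From the hypotheses to an irreducible faithful pair\<close>

context finite_dimensional_leibniz_algebra
begin

text \<open>Every nonzero ideal contains the unique minimal ideal \<open>A\<close>, so its
  complement \<open>B\<close> contains no nonzero ideal. This settles both faithfulness, via the
  annihilator of \<open>A\<close> in \<open>B\<close>, and the non-Lie case, via
  \<open>Leib UNIV \<inter> B\<close>.\<close>

lemma primitive_structure:
  assumes solv: "solvable UNIV" and free: "phi_free" and mns: "minimally_non_supersolvable UNIV"
  obtains A B where "unique_minimal_ideal A" "irreducible_pair scale mult Basis A B"
    "\<not> lie UNIV \<longrightarrow> A = Leib UNIV \<and> product_space A UNIV = {0}"
proof -
  have nss: "\<not> supersolvable UNIV" using mns by (simp add: minimally_non_supersolvable_def)
  have "supersolvable {0}"
    unfolding supersolvable_def by (intro exI[of _ 0] exI[of _ "\<lambda>_. {0}"]) (simp add: ideal_of_def)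
  hence "(UNIV :: 'a set) \<noteq> {0}" using nss by metis
  then obtain A where A: "minimal_ideal A"
    using minimal_ideal_exists[of UNIV] by (auto simp: ideal_of_def)
  have uniq: "I = A" if "minimal_ideal I" for I
    using minimal_ideals_eq[OF solv free mns that A] .
  have least: "A \<subseteq> J" if "ideal_of UNIV J" "J \<noteq> {0}" for J
    using minimal_ideal_exists[OF that] uniq by blast
  have idA: "ideal_of UNIV A" and A0: "A \<noteq> {0}" using A by (auto simp: minimal_ideal_def)
  note sA = ideal_of_subspace[OF idA]
  obtain B where B: "subalgebra B" "B \<noteq> UNIV" "direct_sum A B"
    using minimal_ideal_complement[OF solv free A] .
  note sB = subalgebra_subspace[OF B(1)]
  have AB: "A \<inter> B = {0}" using B(3) by (simp add: direct_sum_def)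
  have AB0: "u = 0" if "u \<in> A" "u \<in> B" for u using AB that by blast
  have not_sub: "J = {0}" if "ideal_of UNIV J" "J \<subseteq> B" for J
  proof (rule ccontr)
    assume "J \<noteq> {0}"
    hence "A \<subseteq> B" using least that by blast
    thus False using AB0 subspace_nontrivial[OF sA A0] by blast
  qed
  have AA: "a \<cdot> a' = 0" if "a \<in> A" "a' \<in> A" for a a'
    using minimal_ideal_abelian[OF solv A that] .
  have Leib: "A = Leib UNIV \<and> product_space A UNIV = {0} \<and> lie B" if nl: "\<not> lie UNIV"
  proof -
    let ?K = "Leib UNIV"
    have sq: "x \<cdot> x \<in> ?K" for x unfolding Leib_def by (rule span_base) blast
    have sK: "subspace ?K" by (simp add: Leib_def)
    have "?K \<noteq> {0}"
    proof
      assume "?K = {0}"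
      hence "x \<cdot> x = 0" for x using sq[of x] by simp
      thus False using nl by (simp add: lie_def)
    qed
    hence AK: "A \<subseteq> ?K" by (rule least[OF ideal_of_Leib])
    have "ideal_of UNIV (?K \<inter> B)"
      unfolding ideal_of_def
    proof (intro conjI ballI)
      show sKB: "subspace (?K \<inter> B)" using sK sB by (rule subspace_inter)
      fix c s assume c: "c \<in> ?K \<inter> B"
      obtain a b where s: "a \<in> A" "b \<in> B" "s = a + b" using direct_sumE[OF B(3)] by metis
      have "a \<cdot> c = 0" using AK s(1) Leib_mult[of a UNIV c] by blast
      hence "s \<cdot> c = b \<cdot> c" by (simp add: s mult_simps)
      moreover have "b \<cdot> c \<in> ?K" using c ideal_of_mult_left[OF ideal_of_Leib] by simp
      moreover have "b \<cdot> c \<in> B" using c s subalgebra_mult[OF B(1)] by simp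
      ultimately show "s \<cdot> c \<in> ?K \<inter> B" by simp
      show "c \<cdot> s \<in> ?K \<inter> B" using c Leib_mult[of c UNIV s] subspace_0[OF sKB] by simp
    qed auto
    hence KB: "?K \<inter> B = {0}" by (rule not_sub) simp
    have "?K \<subseteq> A"
    proof
      fix u assume u: "u \<in> ?K"
      obtain a b where ab: "a \<in> A" "b \<in> B" "u = a + b" using direct_sumE[OF B(3)] by metis
      have "u - a \<in> ?K" using u ab(1) AK by (intro subspace_diff[OF sK]) auto
      hence "b \<in> ?K \<inter> B" using ab by simp
      thus "u \<in> A" using KB ab by simp
    qed
    hence AK: "A = ?K" using AK by simp
    have "product_space A UNIV \<subseteq> {0}"
      unfolding AK by (rule product_space_subset) (auto simp: Leib_mult)
    hence "product_space A UNIV = {0}" using subspace_0[OF subspace_product_space] by blast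
    moreover have "x \<cdot> x = 0" if "x \<in> B" for x
      using KB sq[of x] subalgebra_mult[OF B(1) that that] by blast
    ultimately show ?thesis using AK by (auto simp: lie_def)
  qed
  have lieB: "lie B" using Leib by (cases "lie UNIV") (auto simp: lie_def)
  have AB_mult: "a \<cdot> b = (if lie UNIV then - (b \<cdot> a) else 0)" if "a \<in> A" for a b
  proof (cases "lie UNIV")
    case True
    have "a \<cdot> b = - (b \<cdot> a)" by (rule lie_antisym[OF subspace_UNIV True]) auto
    thus ?thesis using True by (simp only: if_True)
  next
    case False
    hence "a \<in> Leib UNIV" using Leib that by blast
    thus ?thesis using Leib_mult False by simp
  qed
  \<comment> \<open>Right multiplication on \<open>A\<close> is the negative of left multiplication
    or zero, so stability under left multiplication already yields two-sided ideals.\<close>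
  have right_stable: "w \<cdot> s \<in> W" if "w \<in> W" "W \<subseteq> A" "subspace W" "s \<cdot> w \<in> W" for w s W
    using that AB_mult by (auto simp: subspace_neg subspace_0)
  have "irreducible_pair scale mult Basis A B"
  proof unfold_locales
    show "table_conventions A B" using AA AB_mult by (simp add: table_conventions_def)
    show "b \<cdot> a \<in> A" if "a \<in> A" for a b using idA that by (simp add: ideal_of_def)
    show "W = A"
      if W: "subspace W" "W \<subseteq> A" "\<And>b w. b \<in> B \<Longrightarrow> w \<in> W \<Longrightarrow> b \<cdot> w \<in> W" "W \<noteq> {0}" for W
    proof -
      have stable: "s \<cdot> w \<in> W" if w: "w \<in> W" for s w
      proof -
        obtain a b where s: "a \<in> A" "b \<in> B" "s = a + b" using direct_sumE[OF B(3)] by metis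
        hence "s \<cdot> w = b \<cdot> w" using AA[of a w] w W(2) by (auto simp: mult_simps)
        thus ?thesis using W(3) s w by simp
      qed
      hence "ideal_of UNIV W" using W right_stable by (auto simp: ideal_of_def)
      thus ?thesis using A W by (auto simp: minimal_ideal_def)
    qed
    show "b = 0" if b: "b \<in> B" "\<And>a. a \<in> A \<Longrightarrow> b \<cdot> a = 0" for b
    proof -
      let ?C = "{b \<in> B. \<forall>a\<in>A. b \<cdot> a = 0}"
      have "ideal_of UNIV ?C"
        unfolding ideal_of_def
      proof (intro conjI ballI)
        show "subspace ?C"
          using sB by (intro subspaceI) (auto simp: mult_simps subspace_0 subspace_add subspace_scale)
        fix c s assume c: "c \<in> ?C"
        obtain a b where s: "a \<in> A" "b \<in> B" "s = a + b" using direct_sumE[OF B(3)] by metis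
        have "c \<cdot> s = c \<cdot> b" "s \<cdot> c = b \<cdot> c" using s c AB_mult by (auto simp: mult_simps)
        moreover have "c \<cdot> b \<in> B" "b \<cdot> c \<in> B" using c s subalgebra_mult[OF B(1)] by auto
        moreover have "(c \<cdot> b) \<cdot> a' = 0" "(b \<cdot> c) \<cdot> a' = 0" if "a' \<in> A" for a'
          using c that ideal_of_mult_left[OF idA UNIV_I that] by (auto simp: leibniz_left)
        ultimately show "c \<cdot> s \<in> ?C" "s \<cdot> c \<in> ?C" by auto
      qed auto
      hence "?C = {0}" by (rule not_sub) auto
      thus ?thesis using b by blast
    qed
    show "\<exists>w\<in>W. w \<noteq> 0 \<and> (\<forall>s\<in>S. s \<cdot> w \<in> span {w})"
      if S: "subalgebra S" "S \<subset> B" and W: "subspace W" "W \<subseteq> A" "W \<noteq> {0}"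
        "\<And>s w. s \<in> S \<Longrightarrow> w \<in> W \<Longrightarrow> s \<cdot> w \<in> W" for S W
    proof -
      \<comment> \<open>\<open>T = A + S\<close> is a proper subalgebra, hence supersolvable, and
        \<open>W\<close> is an ideal of it; an ideal line of \<open>T\<close> inside
        \<open>W\<close> is spanned by a common eigenvector.\<close>
      define T where "T = {a + s | a s. a \<in> A \<and> s \<in> S}"
      note sS = subalgebra_subspace[OF S(1)]
      have AT: "A \<subseteq> T" unfolding T_def using subspace_0[OF sS] by force
      have ST: "S \<subseteq> T" unfolding T_def using subspace_0[OF sA] by force
      have "subspace T" unfolding T_def using sA sS by (rule subspace_sums)
      moreover have "u \<cdot> v \<in> T" if uv: "u \<in> T" "v \<in> T" for u v
      proof -
        obtain a s a' s' where *: "a \<in> A" "s \<in> S" "a' \<in> A" "s' \<in> S" "u = a + s" "v = a' + s'"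
          using uv unfolding T_def by blast
        have "u \<cdot> v = (a \<cdot> s' + s \<cdot> a') + s \<cdot> s'" using * by (simp add: mult_simps AA)
        moreover have "a \<cdot> s' + s \<cdot> a' \<in> A" "s \<cdot> s' \<in> S"
          using * idA S(1) sA by (auto simp: ideal_of_def subalgebra_def subspace_add)
        ultimately show ?thesis unfolding T_def by blast
      qed
      ultimately have "subalgebra T" unfolding subalgebra_def by blast
      moreover have "T \<noteq> UNIV"
      proof
        assume "T = UNIV"
        obtain b where b: "b \<in> B" "b \<notin> S" using S(2) by blast
        obtain a s where as: "a \<in> A" "s \<in> S" "b = a + s" using \<open>T = UNIV\<close> unfolding T_def by blast
        have "b - s \<in> B" using b as(2) S(2) by (intro subspace_diff[OF sB]) auto
        hence "a = 0" using AB0[of a] as by simp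
        thus False using as b by simp
      qed
      ultimately have "supersolvable T" using mns by (auto simp: minimally_non_supersolvable_def)
      moreover have stable: "s \<cdot> w \<in> W" if tw: "s \<in> T" "w \<in> W" for s w
      proof -
        obtain a s' where s: "a \<in> A" "s' \<in> S" "s = a + s'" using tw(1) unfolding T_def by blast
        hence "s \<cdot> w = s' \<cdot> w" using AA[of a w] tw(2) W(2) by (auto simp: mult_simps)
        thus ?thesis using W(4) s tw(2) by simp
      qed
      have "ideal_of T W"
        using W(1,2) AT stable right_stable[OF _ W(2,1)] by (auto simp: ideal_of_def)
      ultimately obtain w where w: "w \<in> W" "w \<noteq> 0" "ideal_of T (span {w})"
        using supersolvable_ideal_line W(3) by blast
      have "s \<cdot> w \<in> span {w}" if "s \<in> S" for s
        using ideal_of_mult_left[OF w(3)] ST that span_base[of w "{w}"] by blast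
      thus ?thesis using w by blast
    qed
    show "supersolvable B" using mns B by (auto simp: minimally_non_supersolvable_def)
    show "1 < dim A"
    proof (rule ccontr)
      assume d: "\<not> 1 < dim A"
      obtain u where u: "u \<in> A" "u \<noteq> 0" using subspace_nontrivial[OF sA A0] by blast
      have sub: "span {u} \<subseteq> A" using u sA by (intro span_minimal) auto
      have "dim (span {u}) = 1" using u dim_span[of "{u}"] by simp
      hence "span {u} = A" using d sub sA by (intro subspace_dim_equal) auto
      thus False using supersolvable_extension[of u B] idA u B mns nss
        by (auto simp: minimally_non_supersolvable_def)
    qed
  qed (use B lieB in auto)
  moreover have "unique_minimal_ideal A" using A uniq unfolding unique_minimal_ideal_def by blast
  ultimately show thesis using that Leib by blast
qed

end

theorem theorem4p2:
  fixes scale :: "'f::field \<Rightarrow> 'a::ab_group_add \<Rightarrow> 'a"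
    and mult :: "'a \<Rightarrow> 'a \<Rightarrow> 'a" (infixl \<open>\<cdot>\<close> 70)
  assumes "leibniz_algebra scale mult"
    and "\<exists>Basis. finite_dimensional_vector_space scale Basis"
    and "leibniz_algebra.solvable scale mult UNIV"
    and "leibniz_algebra.phi_free scale mult"
    and "leibniz_algebra.minimally_non_supersolvable scale mult UNIV"
  shows
    "(leibniz_algebra.strongly_solvable scale mult UNIV \<longrightarrow>
       (\<exists>A. leibniz_algebra.unique_minimal_ideal scale mult A \<and>
          leibniz_algebra.form_strongly_solvable scale mult A \<and>
          (leibniz_algebra.lie mult UNIV \<longrightarrow> (\<forall>u v. u \<cdot> v = - (v \<cdot> u))) \<and>
          (\<not> leibniz_algebra.lie mult UNIV \<longrightarrow>
             A = leibniz_algebra.Leib scale mult UNIV \<and>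
             leibniz_algebra.product_space scale mult A UNIV = {0}))) \<and>
     (\<not> leibniz_algebra.strongly_solvable scale mult UNIV \<longrightarrow>
       CHAR('f) > 0 \<and>
       (\<exists>A e. leibniz_algebra.unique_minimal_ideal scale mult A \<and>
          leibniz_algebra.cyclic_basis scale e A \<and>
          (leibniz_algebra.form_a scale mult A e \<or> leibniz_algebra.form_b scale mult A e) \<and>
          (leibniz_algebra.lie mult UNIV \<longrightarrow> (\<forall>u v. u \<cdot> v = - (v \<cdot> u))) \<and>
          (\<not> leibniz_algebra.lie mult UNIV \<longrightarrow>
             A = leibniz_algebra.Leib scale mult UNIV \<and>
             leibniz_algebra.product_space scale mult A UNIV = {0})))"
proof -
  obtain Basis where "finite_dimensional_vector_space scale Basis" using assms(2) by blast
  then interpret finite_dimensional_leibniz_algebra scale mult Basis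
    using assms(1) by (intro finite_dimensional_leibniz_algebra.intro)
  obtain A B where A: "unique_minimal_ideal A" and pair: "irreducible_pair scale mult Basis A B"
    and Leib: "\<not> lie UNIV \<longrightarrow> A = Leib UNIV \<and> product_space A UNIV = {0}"
    using primitive_structure[OF assms(3-5)] .
  interpret irreducible_pair scale mult Basis A B by (rule pair)
  have antisym: "lie UNIV \<longrightarrow> (\<forall>u v. u \<cdot> v = - (v \<cdot> u))"
    by (intro impI allI lie_antisym[OF subspace_UNIV] UNIV_I)
  show ?thesis
  proof (cases "strongly_solvable UNIV")
    case True
    note form = form_strongly_solvable_of_strongly_solvable[OF True]
    show ?thesis
      using True A form antisym Leib by (intro conjI impI exI[of _ A]) iprover+
  next
    case False
    then obtain u v where "u \<in> B" "v \<in> B" "u \<cdot> v \<noteq> 0"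
      using strongly_solvable_of_abelian by blast
    then obtain e where "CHAR('f) > 0" "cyclic_basis e A" "form_a A e \<or> form_b A e"
      using forms_of_nonabelian by blast
    thus ?thesis
      using False A antisym Leib by (intro conjI impI exI[of _ A] exI[of _ e]) iprover+
  qed
qed

end
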